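(* (Littlewood's tableau formula.) Let $x=(x_1,x_2,\ldots)$ be an infinite sequence of commuting variables. For every partition $\lambda$, $$s_\lambda(x)=\sum_{T\text{ on }\lambda}x^{c(T)}=\sum_\mu K_{\lambda,\mu}\,m_\mu(x),$$ where the first sum is over all semistandard Young tableaux $T$ of shape $\lambda$, and the second sum is over all partitions $\mu$.
   Context: Let $h_r=h_r(x)$ be the $r$-th complete symmetric function, $\sum_{r\ge 0}h_r(x)t^r=\prod_{i\ge 1}(1-x_it)^{-1}$, with $h_0=1$ and $h_r=0$ for $r<0$; set $h_\alpha=\prod_i h_{\alpha_i}$ for any integer sequence $\alpha$ with finitely many nonzero terms. For $i<j$ let $R_{ij}(\alpha)=(\alpha_1,\ldots,\alpha_i+1,\ldots,\alpha_j-1,\ldots)$, and for a monomial $R$ in the $R_{ij}$ let $R\,h_\alpha:=h_{R\alpha}$ (the operator acts on the index). The Schur function is defined by $s_\alpha:=\prod_{i<j}(1-R_{ij})\,h_\alpha=\det(h_{\alpha_i+j-i})_{1\le i,j\le\ell}$, where $\ell$ is the largest index with $\alpha_\ell\ne 0$. A (semistandard) tableau $T$ of shape $\lambda$ is a filling of the boxes of the Young diagram of $\lambda$ with positive integers, weakly increasing along rows from left to right and strictly increasing down columns; its content is $c(T)=(c_1,c_2,\ldots)$ with $c_i$ the number of entries equal to $i$, and $x^{c(T)}=\prod_i x_i^{c_i}$. $K_{\lambda,\mu}$ (the Kostka number) is the number of semistandard tableaux of shape $\lambda$ and content $\mu$. The monomial symmetric function is $m_\mu(x)=\sum_\alpha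 x^\alpha$, summed over all distinct permutations $\alpha$ of $\mu=(\mu_1,\mu_2,\ldots)$. *)

theory Defs
  imports
    "HOL-Analysis.Function_Topology"
    "HOL-Analysis.Infinite_Sum"
    "HOL-Library.Poly_Mapping"
    "HOL-Library.Multiset"
    "Jordan_Normal_Form.Determinant"
begin

text \<open>Sequences are indexed from zero: the entry at position \<open>i\<close> of a sequence is
  the \<open>(i+1)\<close>-st term in the usual notation, and \<open>xvar i\<close> stands for \<open>x\<^sub>i\<^sub>+\<^sub>1\<close>.
  Sequences with finitely many nonzero terms are elements of \<open>nat \<Rightarrow>\<^sub>0 _\<close>.\<close>


section \<open>Formal power series in infinitely many variables\<close>

lemma finite_add_decomps:
  fixes m :: "nat \<Rightarrow>\<^sub>0 nat"
  shows "finite {(a, b). a + b = m}"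
proof -
  have inj: "inj_on (\<lambda>a. restrict (Poly_Mapping.lookup a) (Poly_Mapping.keys m)) {a. \<exists>b. a + b = m}"
  proof (rule inj_onI)
    fix a b :: "nat \<Rightarrow>\<^sub>0 nat"
    assume ab: "a \<in> {a. \<exists>b. a + b = m}" "b \<in> {a. \<exists>b. a + b = m}"
      and eq: "restrict (Poly_Mapping.lookup a) (Poly_Mapping.keys m) = restrict (Poly_Mapping.lookup b) (Poly_Mapping.keys m)"
    show "a = b"
    proof (rule poly_mapping_eqI)
      fix k
      show "Poly_Mapping.lookup a k = Poly_Mapping.lookup b k"
      proof (cases "k \<in> Poly_Mapping.keys m")
        case True
        then show ?thesis using fun_cong[OF eq, of k] by simp
      next
        case False
        then have "Poly_Mapping.lookup m k = 0" by (simp add: in_keys_iff)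
        with ab have "Poly_Mapping.lookup a k = 0" "Poly_Mapping.lookup b k = 0"
          by (auto simp: lookup_add) (metis add_is_0 lookup_add)
        then show ?thesis by simp
      qed
    qed
  qed
  have "(\<lambda>a. restrict (Poly_Mapping.lookup a) (Poly_Mapping.keys m)) ` {a. \<exists>b. a + b = m}
          \<subseteq> (\<Pi>\<^sub>E k\<in>Poly_Mapping.keys m. {..Poly_Mapping.lookup m k})"
    by (auto simp: lookup_add)
  then have "finite ((\<lambda>a. restrict (Poly_Mapping.lookup a) (Poly_Mapping.keys m)) ` {a. \<exists>b. a + b = m})"
    by (rule finite_subset) (auto intro: finite_PiE)
  then have "finite {a. \<exists>b. a + b = m}"
    using finite_imageD inj by blast
  then have "finite ((\<lambda>a. (a, m - a)) ` {a. \<exists>b. a + b = m})"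
    by simp
  moreover have "{(a, b). a + b = m} \<subseteq> (\<lambda>a. (a, m - a)) ` {a. \<exists>b. a + b = m}"
    by force
  ultimately show ?thesis by (rule rev_finite_subset)
qed

text \<open>A series is the family of its integer coefficients, indexed by the monomials.\<close>

typedef xseries = "UNIV :: ((nat \<Rightarrow>\<^sub>0 nat) \<Rightarrow> int) set"
  morphisms xcoeff Xseries ..

setup_lifting type_definition_xseries

lemma xcoeff_Xseries [simp]: "xcoeff (Xseries f) = f"
  by (simp add: Xseries_inverse)

lemma xseries_eqI: "(\<And>m. xcoeff f m = xcoeff g m) \<Longrightarrow> f = g"
  by (metis ext xcoeff_inject)

instantiation xseries :: comm_ring_1
begin

lift_definition zero_xseries :: xseries is "\<lambda>m. 0" .
lift_definition one_xseries :: xseries is "\<lambda>m. if m = 0 then 1 else 0" .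
lift_definition plus_xseries :: "xseries \<Rightarrow> xseries \<Rightarrow> xseries" is "\<lambda>f g m. f m + g m" .
lift_definition minus_xseries :: "xseries \<Rightarrow> xseries \<Rightarrow> xseries" is "\<lambda>f g m. f m - g m" .
lift_definition uminus_xseries :: "xseries \<Rightarrow> xseries" is "\<lambda>f m. - f m" .
lift_definition times_xseries :: "xseries \<Rightarrow> xseries \<Rightarrow> xseries"
  is "\<lambda>f g m. \<Sum>(a, b) | a + b = m. f a * g b" .

instance
proof
  fix f g h :: xseries
  show "f * g * h = f * (g * h)"
  proof (rule xseries_eqI)
    fix m :: "nat \<Rightarrow>\<^sub>0 nat"
    define F G H where "F = xcoeff f" and "G = xcoeff g" and "H = xcoeff h"
    define D :: "(nat \<Rightarrow>\<^sub>0 nat) \<Rightarrow> _" where "D k = {(a, b). a + b = k}" for k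
    have fin: "finite (D k)" for k by (simp add: D_def finite_add_decomps)
    have "xcoeff (f * g * h) m
            = (\<Sum>p\<in>D m. \<Sum>q\<in>D (fst p). F (fst q) * G (snd q) * H (snd p))"
      by (simp add: times_xseries.rep_eq F_def G_def H_def D_def sum_distrib_right case_prod_beta)
    also have "\<dots> = (\<Sum>(p, q) \<in> Sigma (D m) (\<lambda>p. D (fst p)). F (fst q) * G (snd q) * H (snd p))"
      by (subst sum.Sigma) (auto simp: fin)
    also have "\<dots> = (\<Sum>(p, q) \<in> Sigma (D m) (\<lambda>p. D (snd p)). F (fst p) * (G (fst q) * H (snd q)))"
      by (rule sum.reindex_bij_witness
            [of _ "\<lambda>((a, t), (b, c)). ((a + b, c), (a, b))"
                  "\<lambda>((s, c), (a, b)). ((a, b + c), (b, c))"])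
         (auto simp: algebra_simps D_def)
    also have "\<dots> = (\<Sum>p\<in>D m. \<Sum>q\<in>D (snd p). F (fst p) * (G (fst q) * H (snd q)))"
      by (subst sum.Sigma) (auto simp: fin)
    also have "\<dots> = xcoeff (f * (g * h)) m"
      by (simp add: times_xseries.rep_eq F_def G_def H_def D_def sum_distrib_left case_prod_beta)
    finally show "xcoeff (f * g * h) m = xcoeff (f * (g * h)) m" .
  qed
  show "f * g = g * f"
  proof (rule xseries_eqI)
    fix m
    show "xcoeff (f * g) m = xcoeff (g * f) m"
      unfolding times_xseries.rep_eq
      by (rule sum.reindex_bij_witness[of _ prod.swap prod.swap]) (auto simp: algebra_simps)
  qed
  show "1 * f = f"
  proof (rule xseries_eqI)
    fix m :: "nat \<Rightarrow>\<^sub>0 nat"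
    have "xcoeff (1 * f) m
            = (\<Sum>p\<in>{(a, b). a + b = m}. if p = (0, m) then xcoeff f m else 0)"
      unfolding times_xseries.rep_eq one_xseries.rep_eq
      by (rule sum.cong) (auto split: if_splits)
    also have "\<dots> = xcoeff f m"
      using finite_add_decomps[of m] by (subst sum.delta) auto
    finally show "xcoeff (1 * f) m = xcoeff f m" .
  qed
  show "(f + g) * h = f * h + g * h"
    by (rule xseries_eqI)
       (simp add: times_xseries.rep_eq plus_xseries.rep_eq case_prod_beta
          distrib_right sum.distrib)
  show "(0 :: xseries) \<noteq> 1"
    by (metis one_xseries.rep_eq zero_xseries.rep_eq zero_neq_one)
qed (rule xseries_eqI; simp add: zero_xseries.rep_eq plus_xseries.rep_eq
       minus_xseries.rep_eq uminus_xseries.rep_eq)+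

end

text \<open>Infinite sums and limits of series refer to the product topology on coefficient
  families, the integers being discrete, that is, to coefficientwise convergence.\<close>

instantiation xseries :: t2_space
begin

definition open_xseries :: "xseries set \<Rightarrow> bool"
  where "open_xseries U \<longleftrightarrow> open (Xseries -` U)"

instance
proof
  show "open (UNIV :: xseries set)"
    by (simp add: open_xseries_def)
  show "open (S \<inter> T)" if "open S" "open T" for S T :: "xseries set"
    using that by (simp add: open_xseries_def open_Int)
  show "open (\<Union> K)" if "\<forall>S\<in>K. open S" for K :: "xseries set set"
  proof -
    have "Xseries -` (\<Union> K) = (\<Union>S\<in>K. Xseries -` S)" by auto
    with that show ?thesis by (auto simp: open_xseries_def)
  qed
  fix f g :: xseries
  assume "f \<noteq> g"
  then obtain m where m: "xcoeff f m \<noteq> xcoeff g m" using xseries_eqI by blast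
  define N where "N c = {u :: xseries. xcoeff u m = c}" for c
  have "open (N c)" for c
  proof -
    have "open {u :: (nat \<Rightarrow>\<^sub>0 nat) \<Rightarrow> int. \<forall>i\<in>{m}. u i \<in> {c}}"
      by (rule product_topology_basis') (auto simp: open_discrete)
    then show ?thesis by (simp add: open_xseries_def N_def vimage_def)
  qed
  moreover have "f \<in> N (xcoeff f m)" "g \<in> N (xcoeff g m)"
    and "N (xcoeff f m) \<inter> N (xcoeff g m) = {}"
    using m by (auto simp: N_def)
  ultimately show "\<exists>U V. open U \<and> open V \<and> f \<in> U \<and> g \<in> V \<and> U \<inter> V = {}"
    by blast
qed

end

lemma tendsto_xseries_iff:
  "(f \<longlongrightarrow> l) F \<longleftrightarrow> (\<forall>m. \<forall>\<^sub>F t in F. xcoeff (f t) m = xcoeff l m)"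
proof
  assume lim: "(f \<longlongrightarrow> l) F"
  show "\<forall>m. \<forall>\<^sub>F t in F. xcoeff (f t) m = xcoeff l m"
  proof
    fix m
    have "open {u :: (nat \<Rightarrow>\<^sub>0 nat) \<Rightarrow> int. \<forall>i\<in>{m}. u i \<in> {xcoeff l m}}"
      by (rule product_topology_basis') (auto simp: open_discrete)
    then have "open {u. xcoeff u m = xcoeff l m}"
      by (simp add: open_xseries_def vimage_def)
    from topological_tendstoD[OF lim this]
    show "\<forall>\<^sub>F t in F. xcoeff (f t) m = xcoeff l m" by simp
  qed
next
  assume ev: "\<forall>m. \<forall>\<^sub>F t in F. xcoeff (f t) m = xcoeff l m"
  show "(f \<longlongrightarrow> l) F"
  proof (rule topological_tendstoI)
    fix S assume "open S" "l \<in> S"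
    then have "openin (product_topology (\<lambda>_. euclidean) UNIV) (Xseries -` S)"
      and "xcoeff l \<in> Xseries -` S"
      by (simp_all add: open_xseries_def open_fun_def xcoeff_inverse)
    then obtain X where X: "xcoeff l \<in> Pi\<^sub>E UNIV X"
      "finite {i. X i \<noteq> UNIV}" "Pi\<^sub>E UNIV X \<subseteq> Xseries -` S"
      using product_topology_open_contains_basis[of "\<lambda>_. euclidean" UNIV "Xseries -` S" "xcoeff l"]
      by auto
    have "\<forall>\<^sub>F t in F. \<forall>i\<in>{i. X i \<noteq> UNIV}. xcoeff (f t) i = xcoeff l i"
      by (subst eventually_ball_finite_distrib) (use X(2) ev in auto)
    then show "\<forall>\<^sub>F t in F. f t \<in> S"
    proof (rule eventually_mono)
      fix t assume t: "\<forall>i\<in>{i. X i \<noteq> UNIV}. xcoeff (f t) i = xcoeff l i"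
      have "xcoeff (f t) \<in> Pi\<^sub>E UNIV X"
      proof (rule PiE_I)
        fix i
        show "xcoeff (f t) i \<in> X i"
          using t X(1) by (cases "X i = UNIV") (auto simp: PiE_iff)
      qed simp
      then have "xcoeff (f t) \<in> Xseries -` S" using X(3) by blast
      then show "f t \<in> S" by (simp add: xcoeff_inverse)
    qed
  qed
qed

definition xvar :: "nat \<Rightarrow> xseries"
  where "xvar i = Xseries (\<lambda>m. if m = Poly_Mapping.single i 1 then 1 else 0)"

definition xpow :: "(nat \<Rightarrow>\<^sub>0 nat) \<Rightarrow> xseries"
  where "xpow c = (\<Prod>i\<in>Poly_Mapping.keys c. xvar i ^ Poly_Mapping.lookup c i)"


section \<open>Complete symmetric functions and Schur functions\<close>

text \<open>The generating function \<open>\<Prod>\<^sub>i (1 - x\<^sub>i t)\<^sup>-\<^sup>1\<close> is a power series in \<open>t\<close> over \<open>xseries\<close>,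
  whose coefficients are the limits of those of the partial products. Here
  \<open>fps_right_inverse f 1\<close> is the inverse of a series \<open>f\<close> with constant term \<open>1\<close>.\<close>

definition complete_sym :: "int \<Rightarrow> xseries"
  where "complete_sym r =
    (if r < 0 then 0
     else lim (\<lambda>n. fps_nth (\<Prod>i<n. fps_right_inverse (1 - fps_const (xvar i) * fps_X) 1) (nat r)))"

text \<open>The factors at positions outside \<open>keys \<alpha>\<close> are \<open>h\<^sub>0 = 1\<close>.\<close>

definition complete_sym_seq :: "(nat \<Rightarrow>\<^sub>0 int) \<Rightarrow> xseries"
  where "complete_sym_seq \<alpha> = (\<Prod>i\<in>Poly_Mapping.keys \<alpha>. complete_sym (Poly_Mapping.lookup \<alpha> i))"

definition raise_index :: "nat \<times> nat \<Rightarrow> (nat \<Rightarrow>\<^sub>0 int) \<Rightarrow> (nat \<Rightarrow>\<^sub>0 int)"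
  where "raise_index = (\<lambda>(i, j) \<alpha>. \<alpha> + Poly_Mapping.single i 1 - Poly_Mapping.single j 1)"

text \<open>Polynomials in the raising operators \<open>R\<^sub>i\<^sub>j\<close>: a monomial is the multiset of the
  index pairs \<open>(i, j)\<close> of its factors.\<close>

type_synonym raising_poly = "(nat \<times> nat) multiset \<Rightarrow>\<^sub>0 int"

definition raising_op :: "nat \<times> nat \<Rightarrow> raising_poly"
  where "raising_op p = Poly_Mapping.single {#p#} 1"

definition raising_apply :: "raising_poly \<Rightarrow> (nat \<Rightarrow>\<^sub>0 int) \<Rightarrow> xseries"
  where "raising_apply P \<alpha> =
    (\<Sum>R\<in>Poly_Mapping.keys P. of_int (Poly_Mapping.lookup P R) * complete_sym_seq (fold_mset raise_index \<alpha> R))"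

text \<open>The infinite product of the \<open>1 - R\<^sub>i\<^sub>j\<close> is truncated to the indices below \<open>n\<close>; the
  result does not depend on \<open>n\<close> once \<open>\<alpha>\<close> vanishes from position \<open>n\<close> on.\<close>

definition schur :: "(nat \<Rightarrow>\<^sub>0 int) \<Rightarrow> xseries"
  where "schur \<alpha> =
    lim (\<lambda>n. raising_apply (\<Prod>p\<in>{(i, j). i < j \<and> j < n}. 1 - raising_op p) \<alpha>)"


section \<open>Partitions, tableaux, Kostka numbers and monomial symmetric functions\<close>

definition partition_seq :: "(nat \<Rightarrow>\<^sub>0 nat) \<Rightarrow> bool"
  where "partition_seq lam \<longleftrightarrow> antimono (Poly_Mapping.lookup lam)"

text \<open>The box \<open>(i, j)\<close> lies in row \<open>i\<close> and column \<open>j\<close>.\<close>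

definition young_diagram :: "(nat \<Rightarrow>\<^sub>0 nat) \<Rightarrow> (nat \<times> nat) set"
  where "young_diagram lam = {(i, j). j < Poly_Mapping.lookup lam i}"

lemma finite_young_diagram: "finite (young_diagram lam)"
proof (rule finite_subset)
  show "young_diagram lam \<subseteq> Sigma (Poly_Mapping.keys lam) (\<lambda>i. {..<Poly_Mapping.lookup lam i})"
    by (auto simp: young_diagram_def in_keys_iff)
qed auto

definition tableaux :: "(nat \<Rightarrow>\<^sub>0 nat) \<Rightarrow> (nat \<times> nat \<Rightarrow> nat) set"
  where "tableaux lam =
    {T \<in> young_diagram lam \<rightarrow>\<^sub>E {1..}.
       (\<forall>i j j'. (i, j) \<in> young_diagram lam \<and> (i, j') \<in> young_diagram lam \<and> j < j'
          \<longrightarrow> T (i, j) \<le> T (i, j')) \<and>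
       (\<forall>i i' j. (i, j) \<in> young_diagram lam \<and> (i', j) \<in> young_diagram lam \<and> i < i'
          \<longrightarrow> T (i, j) < T (i', j))}"

text \<open>Position \<open>k\<close> of the content counts the entries equal to \<open>k + 1\<close>.\<close>

lift_definition tableau_content :: "(nat \<Rightarrow>\<^sub>0 nat) \<Rightarrow> (nat \<times> nat \<Rightarrow> nat) \<Rightarrow> (nat \<Rightarrow>\<^sub>0 nat)"
  is "\<lambda>lam T k. card {b \<in> young_diagram lam. T b = Suc k}"
proof -
  fix lam :: "nat \<Rightarrow>\<^sub>0 nat" and T :: "nat \<times> nat \<Rightarrow> nat"
  have "{k. card {b \<in> young_diagram lam. T b = Suc k} \<noteq> 0} \<subseteq> (\<lambda>b. T b - 1) ` young_diagram lam"
  proof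
    fix k assume "k \<in> {k. card {b \<in> young_diagram lam. T b = Suc k} \<noteq> 0}"
    then have "{b \<in> young_diagram lam. T b = Suc k} \<noteq> {}"
      by (metis (mono_tags, lifting) card.empty mem_Collect_eq)
    then obtain b where "b \<in> young_diagram lam" "k = T b - 1" by force
    then show "k \<in> (\<lambda>b. T b - 1) ` young_diagram lam" by blast
  qed
  then show "finite {k. card {b \<in> young_diagram lam. T b = Suc k} \<noteq> 0}"
    using finite_young_diagram finite_subset by blast
qed

definition kostka :: "(nat \<Rightarrow>\<^sub>0 nat) \<Rightarrow> (nat \<Rightarrow>\<^sub>0 nat) \<Rightarrow> nat"
  where "kostka lam \<mu> = card {T \<in> tableaux lam. tableau_content lam T = \<mu>}"

definition rearrangements :: "(nat \<Rightarrow>\<^sub>0 nat) \<Rightarrow> (nat \<Rightarrow>\<^sub>0 nat) set"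
  where "rearrangements \<mu> = {\<alpha>. \<exists>\<pi>. bij \<pi> \<and> Poly_Mapping.lookup \<alpha> = Poly_Mapping.lookup \<mu> \<circ> \<pi>}"

definition monomial_sym :: "(nat \<Rightarrow>\<^sub>0 nat) \<Rightarrow> xseries"
  where "monomial_sym \<mu> = infsum xpow (rearrangements \<mu>)"


section \<open>Explicit form of the limits and infinite sums above\<close>

text \<open>All limits and sums in the definitions exist: \<open>complete_sym r\<close> is the sum of all
  monomials of degree \<open>r\<close>, \<open>schur \<alpha>\<close> is the determinant with entries \<open>complete_sym (\<alpha>\<^sub>i + j - i)\<close>, and
  \<open>monomial_sym \<mu>\<close> is the sum of the monomials with exponents in \<open>rearrangements \<mu>\<close>.\<close>

lemma xcoeff_0 [simp]: "xcoeff 0 m = 0" by (simp add: zero_xseries.rep_eq)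
lemma xcoeff_add [simp]: "xcoeff (f + g) m = xcoeff f m + xcoeff g m" by (simp add: plus_xseries.rep_eq)
lemma xcoeff_sum [simp]: "xcoeff (sum f A) m = (\<Sum>a\<in>A. xcoeff (f a) m)"
  by (induction A rule: infinite_finite_induct) simp_all

lemma mult_monomials:
  "Xseries (\<lambda>m. if m = a then 1 else 0) * Xseries (\<lambda>m. if m = b then 1 else 0)
     = Xseries (\<lambda>m. if m = a + b then 1 else 0)"
proof (rule xseries_eqI)
  fix m :: "nat \<Rightarrow>\<^sub>0 nat"
  have "xcoeff (Xseries (\<lambda>m. if m = a then 1 else 0) * Xseries (\<lambda>m. if m = b then 1 else 0)) m
      = (\<Sum>p\<in>{(c, d). c + d = m}. if p = (a, b) then 1 else 0)"
    unfolding times_xseries.rep_eq by (rule sum.cong) (auto split: if_splits)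
  also have "\<dots> = xcoeff (Xseries (\<lambda>m. if m = a + b then 1 else 0)) m"
    using finite_add_decomps[of m] by (subst sum.delta) auto
  finally show "xcoeff (Xseries (\<lambda>m. if m = a then 1 else 0) * Xseries (\<lambda>m. if m = b then 1 else 0)) m
      = xcoeff (Xseries (\<lambda>m. if m = a + b then 1 else 0)) m" .
qed

lemma xvar_power:
  "xvar i ^ n = Xseries (\<lambda>m. if m = Poly_Mapping.single i n then 1 else 0)"
proof (induction n)
  case 0
  show ?case by (rule xseries_eqI) (simp add: one_xseries.rep_eq)
next
  case (Suc n)
  then show ?case by (simp add: xvar_def mult_monomials flip: single_add)
qed

lemma xpow_eq: "xpow c = Xseries (\<lambda>m. if m = c then 1 else 0)"
proof -
  have "(\<Prod>i\<in>A. xvar i ^ Poly_Mapping.lookup c i) =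
      Xseries (\<lambda>m. if m = (\<Sum>i\<in>A. Poly_Mapping.single i (Poly_Mapping.lookup c i)) then 1 else 0)"
    if "finite A" for A
    using that
  proof induction
    case empty
    show ?case by (rule xseries_eqI) (simp add: one_xseries.rep_eq)
  next
    case (insert x A)
    then show ?case by (simp add: xvar_power mult_monomials)
  qed
  moreover have "(\<Sum>i\<in>Poly_Mapping.keys c. Poly_Mapping.single i (Poly_Mapping.lookup c i)) = c"
    by (rule poly_mapping_eqI) (simp add: lookup_sum lookup_single when_def in_keys_iff)
  ultimately show ?thesis by (simp add: xpow_def)
qed

lemma fps_geometric:
  "fps_right_inverse (1 - fps_const (c :: 'a :: comm_ring_1) * fps_X) 1 = Abs_fps (\<lambda>n. c ^ n)"
proof -
  define F where "F = 1 - fps_const c * fps_X"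
  define G where "G = Abs_fps (\<lambda>n. c ^ n)"
  define H where "H = fps_right_inverse F 1"
  have eq: "G * F = G - G * fps_const c * fps_X"
    unfolding F_def by (simp only: right_diff_distrib mult_1_right mult.assoc)
  have "G * F = 1"
  proof (rule fps_ext)
    fix n
    show "fps_nth (G * F) n = fps_nth 1 n"
      unfolding eq fps_sub_nth fps_X_mult_right_nth
      by (cases n) (simp_all add: G_def mult.commute)
  qed
  have "fps_nth F 0 * 1 = 1" by (simp add: F_def)
  then have "F * H = 1"
    unfolding H_def by (rule fps_right_inverse)
  have "H = (G * F) * H" unfolding \<open>G * F = 1\<close> by (rule mult_1_left[symmetric])
  also have "\<dots> = G * (F * H)" by (rule mult.assoc)
  also have "\<dots> = G" unfolding \<open>F * H = 1\<close> by (rule mult_1_right)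
  finally show ?thesis unfolding F_def G_def H_def .
qed

definition monomial_degree :: "(nat \<Rightarrow>\<^sub>0 nat) \<Rightarrow> nat"
  where "monomial_degree m = (\<Sum>i\<in>Poly_Mapping.keys m. Poly_Mapping.lookup m i)"

lemma monomial_degree_superset:
  "finite A \<Longrightarrow> Poly_Mapping.keys m \<subseteq> A \<Longrightarrow> monomial_degree m = (\<Sum>i\<in>A. Poly_Mapping.lookup m i)"
  unfolding monomial_degree_def by (rule sum.mono_neutral_left) (auto simp: in_keys_iff)

lemma xcoeff_partial_prod:
  "xcoeff (fps_nth (\<Prod>i<n. fps_right_inverse (1 - fps_const (xvar i) * fps_X) 1) r) m
     = (if Poly_Mapping.keys m \<subseteq> {..<n} \<and> monomial_degree m = r then 1 else 0)"
proof (induction n arbitrary: r m)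
  case 0
  show ?case by (auto simp: one_xseries.rep_eq monomial_degree_def)
next
  case (Suc n)
  let ?P = "\<Prod>i<n. fps_right_inverse (1 - fps_const (xvar i) * fps_X) 1"
  define c where "c = Poly_Mapping.lookup m n"
  define b where "b = Poly_Mapping.single n c"
  have mb: "(m - b) + b = m"
    by (rule poly_mapping_eqI) (simp add: lookup_add lookup_minus b_def c_def lookup_single when_def)
  have "xcoeff (fps_nth (\<Prod>i<Suc n. fps_right_inverse (1 - fps_const (xvar i) * fps_X) 1) r) m
      = (\<Sum>k\<le>r. xcoeff (fps_nth ?P k * xvar n ^ (r - k)) m)"
    by (simp add: fps_mult_nth fps_geometric atLeast0AtMost del: fps_right_inverse_constructor.simps)
  also have "\<dots> = (\<Sum>k\<le>r. if Poly_Mapping.keys m \<subseteq> {..<Suc n} \<and> monomial_degree m = r \<and> k + c = r then 1 else 0)"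
  proof (rule sum.cong[OF refl])
    fix k assume "k \<in> {..r}"
    then have k: "k \<le> r" by simp
    have "xcoeff (fps_nth ?P k * xvar n ^ (r - k)) m
        = (\<Sum>(a, d) | a + d = m. if Poly_Mapping.keys a \<subseteq> {..<n} \<and> monomial_degree a = k
              \<and> d = Poly_Mapping.single n (r - k) then 1 else 0)"
      unfolding times_xseries.rep_eq by (rule sum.cong) (auto simp: Suc.IH xvar_power)
    also have "\<dots> = (\<Sum>p\<in>{(a, d). a + d = m}. if p = (m - b, b) then
         (if Poly_Mapping.keys m \<subseteq> {..<Suc n} \<and> monomial_degree m = r \<and> k + c = r then 1 else 0) else 0)"
    proof (rule sum.cong[OF refl], clarify)
      fix a d assume m: "m = a + d"
      show "(if Poly_Mapping.keys a \<subseteq> {..<n} \<and> monomial_degree a = k \<and> d = Poly_Mapping.single n (r - k)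
             then 1 else 0) =
         (if (a, d) = (a + d - b, b) then
         (if Poly_Mapping.keys (a + d) \<subseteq> {..<Suc n} \<and> monomial_degree (a + d) = r \<and> k + c = r then 1 else 0) else 0 :: int)"
      proof -
        have c: "c = Poly_Mapping.lookup a n + Poly_Mapping.lookup d n"
          by (simp add: c_def m lookup_add)
        have "Poly_Mapping.keys a \<subseteq> {..<n} \<and> monomial_degree a = k \<and> d = Poly_Mapping.single n (r - k) \<longleftrightarrow>
          d = b \<and> Poly_Mapping.keys (a + d) \<subseteq> {..<Suc n} \<and> monomial_degree (a + d) = r \<and> k + c = r"
          (is "?L \<longleftrightarrow> ?R")
        proof -
          have 1: "monomial_degree (a + b) = monomial_degree a + c \<and> Poly_Mapping.keys (a + b) \<subseteq> {..<Suc n}"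
            if "Poly_Mapping.keys a \<subseteq> {..<n}"
          proof -
            have kk: "Poly_Mapping.keys (a + b) \<subseteq> {..<Suc n}"
              using that keys_add[of a b] by (auto simp: b_def split: if_splits)
            have "monomial_degree (a + b) = (\<Sum>i<Suc n. Poly_Mapping.lookup (a + b) i)"
              by (rule monomial_degree_superset) (use kk in auto)
            also have "\<dots> = (\<Sum>i<Suc n. Poly_Mapping.lookup a i) + c"
              by (simp add: lookup_add b_def sum.distrib lookup_single when_def)
            also have "(\<Sum>i<Suc n. Poly_Mapping.lookup a i) = monomial_degree a"
              by (rule monomial_degree_superset[symmetric]) (use that in auto)
            finally show ?thesis using kk by simp
          qed
          have 2: "Poly_Mapping.keys a \<subseteq> {..<n}"
            if "d = b" "Poly_Mapping.keys (a + d) \<subseteq> {..<Suc n}"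
          proof
            fix i assume i: "i \<in> Poly_Mapping.keys a"
            then have "i \<in> Poly_Mapping.keys (a + d)" by (simp add: in_keys_iff lookup_add)
            then have "i < Suc n" using that by auto
            moreover have "Poly_Mapping.lookup a n = 0"
              using c that by (simp add: b_def)
            ultimately show "i \<in> {..<n}" using i by (auto simp: in_keys_iff less_Suc_eq)
          qed
          show ?thesis
          proof
            assume L: ?L
            then have "Poly_Mapping.lookup a n = 0" by (auto simp: in_keys_iff)
            with c L have "c = r - k" by simp
            then have "d = b" using L by (simp add: b_def)
            with L 1 \<open>c = r - k\<close> k show ?R by simp
          next
            assume R: ?R
            with 2 1 show ?L by (auto simp: b_def)
          qed
        qed
        moreover have "(a, d) = (a + d - b, b) \<longleftrightarrow> d = b" by auto
        ultimately show ?thesis by auto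
      qed
    qed
    also have "\<dots> = (if Poly_Mapping.keys m \<subseteq> {..<Suc n} \<and> monomial_degree m = r \<and> k + c = r then 1 else 0)"
      using finite_add_decomps[of m] mb by (subst sum.delta) auto
    finally show "xcoeff (fps_nth ?P k * xvar n ^ (r - k)) m = \<dots>" .
  qed
  also have "\<dots> = (if Poly_Mapping.keys m \<subseteq> {..<Suc n} \<and> monomial_degree m = r then 1 else 0)"
  proof (cases "Poly_Mapping.keys m \<subseteq> {..<Suc n} \<and> monomial_degree m = r")
    case True
    then have "c \<le> r"
      using monomial_degree_superset[of "{..<Suc n}" m] by (simp add: c_def)
    then have eq: "k + c = r \<longleftrightarrow> k = r - c" for k by auto
    have "(\<Sum>k\<le>r. if Poly_Mapping.keys m \<subseteq> {..<Suc n} \<and> monomial_degree m = r \<and> k + c = r then 1 else 0)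
        = (\<Sum>k\<le>r. if k = r - c then 1 else 0 :: int)"
      using True by (simp only: eq simp_thms)
    with True show ?thesis by simp
  next
    case False
    then have "(Poly_Mapping.keys m \<subseteq> {..<Suc n} \<and> monomial_degree m = r \<and> k + c = r) = False" for k
      by blast
    with False show ?thesis by (simp only: if_False sum.neutral_const)
  qed
  finally show ?case .
qed

lemma complete_sym_int:
  "complete_sym (int r) = Xseries (\<lambda>m. if monomial_degree m = r then 1 else 0)"
proof -
  have "(\<lambda>n. fps_nth (\<Prod>i<n. fps_right_inverse (1 - fps_const (xvar i) * fps_X) 1) r)
     \<longlonglongrightarrow> Xseries (\<lambda>m. if monomial_degree m = r then 1 else 0)"
  proof (unfold tendsto_xseries_iff xcoeff_partial_prod xcoeff_Xseries, rule allI)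
    fix m :: "nat \<Rightarrow>\<^sub>0 nat"
    obtain N where N: "Poly_Mapping.keys m \<subseteq> {..<N}"
      using finite_nat_iff_bounded finite_keys by blast
    show "\<forall>\<^sub>F n in sequentially. (if Poly_Mapping.keys m \<subseteq> {..<n} \<and> monomial_degree m = r then 1 else 0)
       = (if monomial_degree m = r then 1 else 0 :: int)"
      using eventually_ge_at_top[of N] by eventually_elim (use N in auto)
  qed
  then show ?thesis by (simp add: complete_sym_def limI)
qed

lemma complete_sym_0: "complete_sym 0 = 1"
proof -
  have "complete_sym (int 0) = 1"
    unfolding complete_sym_int by (rule xseries_eqI) (auto simp: one_xseries.rep_eq monomial_degree_def in_keys_iff poly_mapping_eq_iff fun_eq_iff)
  then show ?thesis by simp
qed


lemma complete_sym_neg: "r < 0 \<Longrightarrow> complete_sym r = 0"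
  by (simp add: complete_sym_def)

definition lin_ext :: "('k \<Rightarrow> xseries) \<Rightarrow> ('k \<Rightarrow>\<^sub>0 int) \<Rightarrow> xseries"
  where "lin_ext g P = (\<Sum>k\<in>Poly_Mapping.keys P. of_int (Poly_Mapping.lookup P k) * g k)"

lemma lin_ext_superset:
  "finite A \<Longrightarrow> Poly_Mapping.keys P \<subseteq> A \<Longrightarrow>
     lin_ext g P = (\<Sum>k\<in>A. of_int (Poly_Mapping.lookup P k) * g k)"
  unfolding lin_ext_def by (rule sum.mono_neutral_left) (auto simp: in_keys_iff)

lemma lin_ext_add: "lin_ext g (P + Q) = lin_ext g P + lin_ext g Q"
proof -
  let ?A = "Poly_Mapping.keys P \<union> Poly_Mapping.keys Q"
  have "lin_ext g (P + Q) = (\<Sum>k\<in>?A. of_int (Poly_Mapping.lookup (P + Q) k) * g k)"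
    by (rule lin_ext_superset) (use keys_add[of P Q] in auto)
  moreover have "lin_ext g P = (\<Sum>k\<in>?A. of_int (Poly_Mapping.lookup P k) * g k)"
    by (rule lin_ext_superset) auto
  moreover have "lin_ext g Q = (\<Sum>k\<in>?A. of_int (Poly_Mapping.lookup Q k) * g k)"
    by (rule lin_ext_superset) auto
  ultimately show ?thesis by (simp add: lookup_add distrib_right sum.distrib)
qed

lemma lin_ext_single: "lin_ext g (Poly_Mapping.single k c) = of_int c * g k"
  by (simp add: lin_ext_def)

lemma lin_ext_sum: "lin_ext g (sum P A) = (\<Sum>a\<in>A. lin_ext g (P a))"
  by (induction A rule: infinite_finite_induct) (simp_all add: lin_ext_add, simp_all add: lin_ext_def)

lemma prod_single:
  fixes f :: "'a \<Rightarrow> 'k :: comm_monoid_add" and c :: "'a \<Rightarrow> int"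
  shows "(\<Prod>a\<in>A. Poly_Mapping.single (f a) (c a)) = Poly_Mapping.single (sum f A) (prod c A)"
  by (induction A rule: infinite_finite_induct) (simp_all add: mult_single)

lemma prod_one_minus_single:
  fixes f :: "'a \<Rightarrow> 'k :: comm_monoid_add"
  assumes "finite A"
  shows "(\<Prod>a\<in>A. 1 - Poly_Mapping.single (f a) (1 :: int)) =
     (\<Sum>S\<in>Pow A. Poly_Mapping.single (sum f S) ((- 1) ^ card S))"
proof -
  have "(\<Prod>a\<in>A. 1 - Poly_Mapping.single (f a) (1 :: int))
      = (\<Prod>a\<in>A. Poly_Mapping.single (f a) (- 1) + 1)"
    by (simp add: single_uminus)
  then show ?thesis
    using assms by (simp add: prod_add prod_single)
qed

definition shift :: "nat \<times> nat \<Rightarrow> (nat \<Rightarrow>\<^sub>0 int)"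
  where "shift = (\<lambda>(i, j). Poly_Mapping.single i 1 - Poly_Mapping.single j 1)"

lemma raise_index_eq: "raise_index p \<alpha> = \<alpha> + shift p"
  by (cases p) (simp add: raise_index_def shift_def)

lemma fold_raise_index:
  "finite S \<Longrightarrow> fold_mset raise_index \<alpha> (mset_set S) = \<alpha> + sum shift S"
proof (induction S rule: finite_induct)
  case (insert p S)
  interpret comp_fun_commute raise_index
    by standard (auto simp: raise_index_eq algebra_simps)
  from insert have "fold_mset raise_index \<alpha> (mset_set (insert p S)) = raise_index p (\<alpha> + sum shift S)"
    by simp
  also have "raise_index p (\<alpha> + sum shift S) = \<alpha> + sum shift (insert p S)"
    using insert.hyps by (simp add: raise_index_eq ac_simps)
  finally show ?case .
qed simp

lemma raising_apply_prod:
  assumes "finite A"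
  shows "raising_apply (\<Prod>p\<in>A. 1 - raising_op p) \<alpha>
     = lin_ext (\<lambda>\<gamma>. complete_sym_seq (\<alpha> + \<gamma>)) (\<Prod>p\<in>A. 1 - Poly_Mapping.single (shift p) 1)"
proof -
  have "raising_apply P \<alpha> = lin_ext (\<lambda>R. complete_sym_seq (fold_mset raise_index \<alpha> R)) P" for P
    by (simp add: raising_apply_def lin_ext_def)
  then show ?thesis
    using assms unfolding raising_op_def
    by (auto simp: prod_one_minus_single lin_ext_sum lin_ext_single fold_raise_index finite_subset
          intro!: sum.cong)
qed

lemma det_vandermonde:
  fixes y :: "nat \<Rightarrow> 'a :: comm_ring_1"
  shows "det (mat n n (\<lambda>(i, j). y i ^ j)) = (\<Prod>i<n. \<Prod>k<i. y i - y k)"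
proof -
  define p where "p j = (\<Prod>k<j. [:- y k, 1:])" for j
  have p: "coeff (p j) j = 1 \<and> (\<forall>k>j. coeff (p j) k = 0)" for j
  proof (induction j)
    case 0
    show ?case by (simp add: p_def)
  next
    case (Suc j)
    have "p (Suc j) = smult (- y j) (p j) + pCons 0 (p j)"
      by (simp add: p_def)
    with Suc show ?case by (auto simp: coeff_pCons split: nat.split)
  qed
  define V where "V = mat n n (\<lambda>(i, j). y i ^ j)"
  define U where "U = mat n n (\<lambda>(k, j). coeff (p j) k)"
  have VU: "V * U = mat n n (\<lambda>(i, j). \<Prod>k<j. y i - y k)"
  proof (rule eq_matI)
    fix i j assume "i < dim_row (mat n n (\<lambda>(i, j). \<Prod>k<j. y i - y k))"
      and "j < dim_col (mat n n (\<lambda>(i, j). \<Prod>k<j. y i - y k))"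
    then have ij: "i < n" "j < n" by simp_all
    have deg: "degree (p j) < n"
      using p[of j] ij by (meson degree_le le_less_trans)
    have "(V * U) $$ (i, j) = (\<Sum>k<n. coeff (p j) k * y i ^ k)"
      using ij by (simp add: V_def U_def times_mat_def scalar_prod_def atLeast0LessThan mult.commute)
    also have "\<dots> = (\<Sum>k\<le>degree (p j). coeff (p j) k * y i ^ k)"
      by (rule sum.mono_neutral_right) (use deg in \<open>auto simp: coeff_eq_0\<close>)
    also have "\<dots> = poly (p j) (y i)"
      by (simp add: poly_altdef)
    finally show "(V * U) $$ (i, j) = mat n n (\<lambda>(i, j). \<Prod>k<j. y i - y k) $$ (i, j)"
      using ij by (simp add: p_def poly_prod)
  qed (simp_all add: V_def U_def)
  have carr: "V \<in> carrier_mat n n" "U \<in> carrier_mat n n" by (simp_all add: V_def U_def)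
  have "det U = prod_list (diag_mat U)"
    by (rule det_upper_triangular[of _ n]) (use p in \<open>auto simp: U_def upper_triangular_def\<close>)
  also have "\<dots> = 1"
    using p by (simp add: prod_list_diag_prod U_def)
  finally have "det U = 1" .
  moreover have "det (V * U) = prod_list (diag_mat (V * U))"
    by (rule det_lower_triangular[of n]) (auto simp: VU intro: prod_zero[OF _ bexI])
  moreover have "prod_list (diag_mat (V * U)) = (\<Prod>i<n. \<Prod>k<i. y i - y k)"
    by (simp add: prod_list_diag_prod VU atLeast0LessThan)
  ultimately show ?thesis
    using det_mult[OF carr] by (simp add: V_def)
qed

lemma det_scale_rows:
  fixes A :: "nat \<Rightarrow> nat \<Rightarrow> 'a :: comm_ring_1"
  shows "det (mat n n (\<lambda>(i, j). c i * A i j)) = (\<Prod>i<n. c i) * det (mat n n (\<lambda>(i, j). A i j))"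
proof -
  have "(\<Prod>i<n. mat n n (\<lambda>(i, j). c i * A i j) $$ (i, p i))
      = (\<Prod>i<n. c i) * (\<Prod>i<n. mat n n (\<lambda>(i, j). A i j) $$ (i, p i))"
    if "p permutes {..<n}" for p
    unfolding prod.distrib [symmetric]
    by (rule prod.cong) (use that permutes_in_image[OF that] in auto)
  then show ?thesis
    by (simp add: det_def sum_distrib_left atLeast0LessThan ac_simps)
qed

lemma prod_raising_det:
  "(\<Prod>p\<in>{(i, j). i < j \<and> j < n}. 1 - Poly_Mapping.single (shift p) (1 :: int))
     = det (mat n n (\<lambda>(i, j). Poly_Mapping.single (Poly_Mapping.single i (int j - int i)) 1))"
proof -
  define Y where "Y i = Poly_Mapping.single (Poly_Mapping.single i (1 :: int)) (1 :: int)" for i :: nat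
  define Z where "Z i = Poly_Mapping.single (Poly_Mapping.single i (- 1 :: int)) (1 :: int)" for i :: nat
  have Ypow: "Y i ^ j = Poly_Mapping.single (Poly_Mapping.single i (int j)) 1" for i j
    by (induction j) (simp_all add: Y_def mult_single flip: single_add)
  have Zpow: "Z i ^ j = Poly_Mapping.single (Poly_Mapping.single i (- int j)) 1" for i j
    by (induction j) (simp_all add: Z_def mult_single flip: single_add)
  have ZY: "1 - Poly_Mapping.single (shift (k, i)) 1 = Z i * (Y i - Y k)" for i k
  proof -
    have "shift (k, i) = Poly_Mapping.single i (- 1) + Poly_Mapping.single k 1"
      by (simp add: shift_def single_uminus)
    then have "Z i * Y k = Poly_Mapping.single (shift (k, i)) 1"
      by (simp add: Y_def Z_def mult_single)
    moreover have "Z i * Y i = 1"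
      by (simp add: Y_def Z_def mult_single flip: single_add)
    ultimately show ?thesis by (simp add: right_diff_distrib)
  qed
  have "(\<Prod>p\<in>{(i, j). i < j \<and> j < n}. 1 - Poly_Mapping.single (shift p) (1 :: int))
     = (\<Prod>(i, k)\<in>Sigma {..<n} (\<lambda>i. {..<i}). 1 - Poly_Mapping.single (shift (k, i)) 1)"
    by (rule prod.reindex_bij_witness[of _ prod.swap prod.swap]) auto
  also have "\<dots> = (\<Prod>i<n. \<Prod>k<i. 1 - Poly_Mapping.single (shift (k, i)) 1)"
    by (subst prod.Sigma) auto
  also have "\<dots> = (\<Prod>i<n. \<Prod>k<i. Z i * (Y i - Y k))"
    by (simp only: ZY)
  also have "\<dots> = (\<Prod>i<n. Z i ^ i) * (\<Prod>i<n. \<Prod>k<i. Y i - Y k)"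
    by (simp add: prod.distrib)
  also have "\<dots> = det (mat n n (\<lambda>(i, j). Z i ^ i * Y i ^ j))"
    by (simp add: det_scale_rows det_vandermonde)
  also have "(\<lambda>(i, j). Z i ^ i * Y i ^ j)
      = (\<lambda>(i, j). Poly_Mapping.single (Poly_Mapping.single i (int j - int i)) 1)"
    by (simp add: Ypow Zpow mult_single fun_eq_iff flip: single_add)
  finally show ?thesis .
qed

lemma complete_sym_seq_superset:
  "Poly_Mapping.keys \<alpha> \<subseteq> {..<n} \<Longrightarrow>
     complete_sym_seq \<alpha> = (\<Prod>i<n. complete_sym (Poly_Mapping.lookup \<alpha> i))"
  unfolding complete_sym_seq_def
  by (rule prod.mono_neutral_left) (auto simp: in_keys_iff complete_sym_0)

lemma raising_apply_det:
  assumes "Poly_Mapping.keys \<alpha> \<subseteq> {..<n}"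
  shows "raising_apply (\<Prod>p\<in>{(i, j). i < j \<and> j < n}. 1 - raising_op p) \<alpha>
     = det (mat n n (\<lambda>(i, j). complete_sym (Poly_Mapping.lookup \<alpha> i + int j - int i)))"
proof -
  let ?H = "\<lambda>\<gamma>. complete_sym_seq (\<alpha> + \<gamma>)"
  let ?s = "\<lambda>p. \<Sum>i<n. Poly_Mapping.single i (int (p i) - int i)"
  have "{(i, j). i < j \<and> j < n} \<subseteq> {..<n} \<times> {..<n}" by auto
  then have fin: "finite {(i, j). i < j \<and> j < n}" by (rule finite_subset) auto
  have sgn: "signof p * Poly_Mapping.single k 1 = Poly_Mapping.single k (sign p)"
    for p :: "nat \<Rightarrow> nat" and k :: "nat \<Rightarrow>\<^sub>0 int"
    by (cases p rule: sign_cases) (simp_all add: single_uminus)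
  have "det (mat n n (\<lambda>(i, j). Poly_Mapping.single (Poly_Mapping.single i (int j - int i)) 1))
      = (\<Sum>p | p permutes {..<n}. Poly_Mapping.single (?s p) (sign p))"
    unfolding det_def
    by (auto simp: atLeast0LessThan permutes_in_image prod_single sgn intro!: sum.cong)
  then have "raising_apply (\<Prod>p\<in>{(i, j). i < j \<and> j < n}. 1 - raising_op p) \<alpha>
      = (\<Sum>p | p permutes {..<n}. of_int (sign p) * ?H (?s p))"
    by (simp add: raising_apply_prod fin prod_raising_det lin_ext_sum lin_ext_single)
  also have "\<dots> = (\<Sum>p | p permutes {..<n}. signof p *
      (\<Prod>i<n. complete_sym (Poly_Mapping.lookup \<alpha> i + int (p i) - int i)))"
  proof (intro sum.cong arg_cong2[where f = "(*)"] refl)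
    fix p
    have l: "Poly_Mapping.lookup (?s p) i = (if i < n then int (p i) - int i else 0)" for i
      by (simp add: lookup_sum lookup_single when_def)
    have "Poly_Mapping.keys (\<alpha> + ?s p) \<subseteq> {..<n}"
      using assms by (auto simp: in_keys_iff lookup_add l split: if_splits)
    then show "?H (?s p) = (\<Prod>i<n. complete_sym (Poly_Mapping.lookup \<alpha> i + int (p i) - int i))"
      by (simp add: complete_sym_seq_superset lookup_add l add_diff_eq)
  qed
  also have "\<dots> = det (mat n n (\<lambda>(i, j). complete_sym (Poly_Mapping.lookup \<alpha> i + int j - int i)))"
    unfolding det_def
    by (auto simp: atLeast0LessThan permutes_in_image intro!: sum.cong)
  finally show ?thesis .
qed

theorem schur_eq_det:
  assumes "Poly_Mapping.keys \<alpha> \<subseteq> {..<l}"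
  shows "schur \<alpha> = det (mat l l (\<lambda>(i, j). complete_sym (Poly_Mapping.lookup \<alpha> i + int j - int i)))"
proof -
  define M where "M n = mat n n (\<lambda>(i, j). complete_sym (Poly_Mapping.lookup \<alpha> i + int j - int i))" for n
  have step: "det (M (Suc n)) = det (M n)" if "l \<le> n" for n
  proof -
    have 0: "Poly_Mapping.lookup \<alpha> n = 0"
      using assms that by (metis in_keys_iff lessThan_iff linorder_not_le subsetD)
    have row: "M (Suc n) $$ (n, j) = (if j = n then 1 else 0)" if "j < Suc n" for j
      using that by (simp add: M_def 0 complete_sym_0 complete_sym_neg)
    have "det (M (Suc n)) = (\<Sum>j<Suc n. M (Suc n) $$ (n, j) * cofactor (M (Suc n)) n j)"
      by (rule laplace_expansion_row) (simp_all add: M_def)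
    also have "\<dots> = (\<Sum>j<Suc n. if j = n then cofactor (M (Suc n)) n n else 0)"
      by (rule sum.cong) (simp_all add: row)
    also have "\<dots> = cofactor (M (Suc n)) n n" by simp
    also have "mat_delete (M (Suc n)) n n = M n"
      by (rule eq_matI) (auto simp: M_def mat_delete_def)
    then have "cofactor (M (Suc n)) n n = det (M n)"
      by (simp add: cofactor_def)
    finally show ?thesis .
  qed
  have stable: "det (M n) = det (M l)" if "l \<le> n" for n
    using that by (induction n rule: dec_induct) (simp_all add: step)
  have "\<forall>\<^sub>F n in sequentially.
      raising_apply (\<Prod>p\<in>{(i, j). i < j \<and> j < n}. 1 - raising_op p) \<alpha> = det (M l)"
    using eventually_ge_at_top[of l]
  proof eventually_elim
    case (elim n)
    with assms have "Poly_Mapping.keys \<alpha> \<subseteq> {..<n}" by auto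
    then show ?case using raising_apply_det stable[OF elim] by (simp add: M_def)
  qed
  then have "(\<lambda>n. raising_apply (\<Prod>p\<in>{(i, j). i < j \<and> j < n}. 1 - raising_op p) \<alpha>)
     \<longlonglongrightarrow> det (M l)"
    by (rule tendsto_eventually)
  then show ?thesis by (simp add: schur_def limI M_def)
qed

lemma has_sum_xpow: "(xpow has_sum Xseries (\<lambda>m. if m \<in> A then 1 else 0)) A"
proof (unfold has_sum_def tendsto_xseries_iff, rule allI)
  fix m
  have ev: "\<forall>\<^sub>F F in finite_subsets_at_top A. A \<inter> {m} \<subseteq> F \<and> finite F \<and> F \<subseteq> A"
    by (subst eventually_finite_subsets_at_top) (rule exI[of _ "A \<inter> {m}"], auto)
  then show "\<forall>\<^sub>F F in finite_subsets_at_top A.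
      xcoeff (sum xpow F) m = xcoeff (Xseries (\<lambda>m. if m \<in> A then 1 else 0)) m"
  proof eventually_elim
    case (elim F)
    then have "m \<in> F \<longleftrightarrow> m \<in> A" by auto
    with elim show ?case by (simp add: xpow_eq)
  qed
qed

lemma monomial_sym_eq:
  "monomial_sym \<mu> = Xseries (\<lambda>m. if m \<in> rearrangements \<mu> then 1 else 0)"
  unfolding monomial_sym_def using has_sum_xpow by (rule infsumI)

end

theory Submission
  imports Defs
begin

text \<open>The Jacobi--Trudi determinant and the generating function of semistandard tableaux
  satisfy the same recursion in the number \<open>n\<close> of variables, the branching rule
  \<open>f\<^sub>\<lambda>(x\<^sub>1, \<dots>, x\<^sub>n\<^sub>+\<^sub>1) = \<Sum>\<^sub>\<mu> x\<^sub>n\<^sub>+\<^sub>1\<^bsup>|\<lambda>| - |\<mu>|\<^esup> f\<^sub>\<mu>(x\<^sub>1, \<dots>, x\<^sub>n)\<close>, where \<open>\<mu>\<close> runs over the shapes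
  interlacing with \<open>\<lambda>\<close>: \<open>\<lambda>\<^sub>i\<^sub>+\<^sub>1 \<le> \<mu>\<^sub>i \<le> \<lambda>\<^sub>i\<close> for all \<open>i\<close>. Since they also agree without variables, they
  are equal for every \<open>n\<close> (\<open>jacobi_trudi_eq_sum_tableaux\<close>).

  For tableaux the rule (\<open>tableaux_branching\<close>) comes from removing the boxes with the largest
  possible entry \<open>n + 1\<close>, which form a horizontal strip. For determinants
  (\<open>jacobi_trudi_branching\<close>) it comes from \<open>h\<^sub>r(x\<^sub>1, \<dots>, x\<^sub>n\<^sub>+\<^sub>1) = h\<^sub>r(x\<^sub>1, \<dots>, x\<^sub>n) + x\<^sub>n\<^sub>+\<^sub>1 h\<^sub>r\<^sub>-\<^sub>1(x\<^sub>1, \<dots>, x\<^sub>n\<^sub>+\<^sub>1)\<close>.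
  Expanding every row completely by this identity would give far too many terms, to be cancelled
  by a sign-reversing involution. Instead, a multiple of the next row is first subtracted from
  each row, which leaves in row \<open>i\<close> exactly the terms with \<open>\<lambda>\<^sub>i\<^sub>+\<^sub>1 \<le> \<mu>\<^sub>i \<le> \<lambda>\<^sub>i\<close>; multilinearity in the
  rows then gives the rule with no cancellation.

  Any given monomial involves finitely many variables, and setting the others to zero is a ring
  homomorphism; hence the coefficient of \<open>x\<^sup>m\<close> in \<open>s\<^sub>\<lambda>\<close> is the number of tableaux of content \<open>m\<close>, for
  every exponent \<open>m\<close> (\<open>xcoeff_schur\<close>), which is the first expansion. Permuting the variables is a
  ring homomorphism as well and fixes all \<open>h\<^sub>r\<close>, so these numbers are invariant under
  rearranging \<open>m\<close> (\<open>kostka_rearrangement\<close>). As every \<open>m\<close> is a rearrangement of exactly one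
  partition, collecting the monomials by these classes yields the second expansion.\<close>

section \<open>Monomials and ring homomorphisms on series\<close>

lemma keys_add_nat:
  fixes a b :: "nat \<Rightarrow>\<^sub>0 nat"
  shows "Poly_Mapping.keys (a + b) = Poly_Mapping.keys a \<union> Poly_Mapping.keys b"
  by (auto simp: in_keys_iff lookup_add)

lemma lookup_eq_0_of_keys:
  fixes n i :: nat
  assumes "Poly_Mapping.keys m \<subseteq> {..<n}" and "n \<le> i"
  shows "Poly_Mapping.lookup m i = 0"
proof -
  have "i \<notin> Poly_Mapping.keys m" using assms by auto
  then show ?thesis by (simp add: in_keys_iff)
qed

lemma monomial_degree_add: "monomial_degree (a + b) = monomial_degree a + monomial_degree b"
proof -
  let ?K = "Poly_Mapping.keys a \<union> Poly_Mapping.keys b"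
  have "monomial_degree c = (\<Sum>i\<in>?K. Poly_Mapping.lookup c i)" if "Poly_Mapping.keys c \<subseteq> ?K" for c
    using that by (intro monomial_degree_superset) auto
  from this[of "a + b"] this[of a] this[of b] show ?thesis
    by (simp add: keys_add_nat lookup_add sum.distrib)
qed

lemma xcoeff_mult: "xcoeff (f * g) m = (\<Sum>(a, b) | a + b = m. xcoeff f a * xcoeff g b)"
  by (simp add: times_xseries.rep_eq)

lemma xcoeff_one: "xcoeff 1 m = (if m = 0 then 1 else 0)"
  by (simp add: one_xseries.rep_eq)

lemma xcoeff_of_nat_mult: "xcoeff (of_nat k * f) m = int k * xcoeff f m"
  by (induction k) (simp_all add: distrib_right)

lemma xpow_add: "xpow (a + b) = xpow a * xpow b"
  by (simp add: xpow_eq mult_monomials)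

lemma xvar_power_eq_xpow: "xvar i ^ k = xpow (Poly_Mapping.single i k)"
  by (simp add: xvar_power xpow_eq)

lemma xcoeff_xvar_mult:
  "xcoeff (xvar i * f) m =
     (if Poly_Mapping.lookup m i = 0 then 0 else xcoeff f (m - Poly_Mapping.single i 1))"
proof -
  let ?s = "Poly_Mapping.single i (1 :: nat)"
  have "xcoeff (xvar i * f) m
      = (\<Sum>p\<in>{(a, b). a + b = m}. if p = (?s, m - ?s) then xcoeff f (m - ?s) else 0)"
    unfolding xcoeff_mult xvar_def by (rule sum.cong) (auto split: if_splits)
  also have "\<dots> = (if ?s + (m - ?s) = m then xcoeff f (m - ?s) else 0)"
    using finite_add_decomps[of m] by (subst sum.delta) auto
  also have "?s + (m - ?s) = m \<longleftrightarrow> Poly_Mapping.lookup m i \<noteq> 0"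
    by (auto simp: poly_mapping_eq_iff fun_eq_iff lookup_add lookup_minus lookup_single when_def
        split: if_splits)
  finally show ?thesis by simp
qed

text \<open>Stated by coefficients for all integers \<open>r\<close>: for negative \<open>r\<close> no degree matches, so that no
  case distinction is needed later.\<close>

lemma xcoeff_complete_sym:
  "xcoeff (complete_sym r) m = (if int (monomial_degree m) = r then 1 else 0)"
proof (cases r)
  case (nonneg k)
  then show ?thesis by (simp add: complete_sym_int)
next
  case (neg k)
  then show ?thesis by (simp add: complete_sym_neg)
qed

text \<open>Setting all variables from position \<open>n\<close> on to zero.\<close>

definition restrict_vars :: "nat \<Rightarrow> xseries \<Rightarrow> xseries"
  where "restrict_vars n f = Xseries (\<lambda>m. if Poly_Mapping.keys m \<subseteq> {..<n} then xcoeff f m else 0)"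

text \<open>A product of two monomials lies in the first \<open>n\<close> variables only if both factors do, so
  every decomposition of such an exponent is kept and all others contribute zero on both sides.\<close>

lemma restrict_vars_hom: "comm_ring_hom (restrict_vars n)"
proof
  fix f g
  show "restrict_vars n (f * g) = restrict_vars n f * restrict_vars n g"
  proof (rule xseries_eqI)
    fix m
    have "(if Poly_Mapping.keys m \<subseteq> {..<n} then \<Sum>(a, b) | a + b = m. xcoeff f a * xcoeff g b else 0)
        = (\<Sum>(a, b) | a + b = m. (if Poly_Mapping.keys m \<subseteq> {..<n} then xcoeff f a * xcoeff g b else 0))"
      by simp
    also have "\<dots> = (\<Sum>(a, b) | a + b = m.
        (if Poly_Mapping.keys a \<subseteq> {..<n} then xcoeff f a else 0)
        * (if Poly_Mapping.keys b \<subseteq> {..<n} then xcoeff g b else 0))"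
      by (rule sum.cong) (auto simp: keys_add_nat)
    finally show "xcoeff (restrict_vars n (f * g)) m = xcoeff (restrict_vars n f * restrict_vars n g) m"
      unfolding restrict_vars_def xcoeff_mult xcoeff_Xseries .
  qed
qed (rule xseries_eqI; simp add: restrict_vars_def xcoeff_one)+

definition permute_vars :: "(nat \<Rightarrow> nat) \<Rightarrow> xseries \<Rightarrow> xseries"
  where "permute_vars \<pi> f = Xseries (\<lambda>m. xcoeff f (Poly_Mapping.map_key \<pi> m))"

lemma lookup_map_key: "inj \<pi> \<Longrightarrow> Poly_Mapping.lookup (Poly_Mapping.map_key \<pi> m) i = Poly_Mapping.lookup m (\<pi> i)"
  by (simp add: map_key.rep_eq)

lemma map_key_inverse:
  assumes "bij \<pi>"
  shows "Poly_Mapping.map_key \<pi> (Poly_Mapping.map_key (inv_into UNIV \<pi>) m) = m"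
    and "Poly_Mapping.map_key (inv_into UNIV \<pi>) (Poly_Mapping.map_key \<pi> m) = m"
  using assms bij_imp_bij_inv[OF assms]
  by (auto intro!: poly_mapping_eqI simp: lookup_map_key bij_is_inj bij_inv_eq_iff bij_is_surj surj_f_inv_f)

lemma permute_vars_hom:
  assumes "bij \<pi>"
  shows "comm_ring_hom (permute_vars \<pi>)"
proof
  note inj = bij_is_inj[OF assms] bij_is_inj[OF bij_imp_bij_inv[OF assms]]
  fix f g
  show "permute_vars \<pi> (f * g) = permute_vars \<pi> f * permute_vars \<pi> g"
  proof (rule xseries_eqI)
    fix m
    have "(\<Sum>(a, b) | a + b = Poly_Mapping.map_key \<pi> m. xcoeff f a * xcoeff g b)
        = (\<Sum>(a, b) | a + b = m. xcoeff f (Poly_Mapping.map_key \<pi> a) * xcoeff g (Poly_Mapping.map_key \<pi> b))"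
      by (rule sum.reindex_bij_witness[of _
            "\<lambda>(a, b). (Poly_Mapping.map_key \<pi> a, Poly_Mapping.map_key \<pi> b)"
            "\<lambda>(a, b). (Poly_Mapping.map_key (inv_into UNIV \<pi>) a, Poly_Mapping.map_key (inv_into UNIV \<pi>) b)"])
        (auto simp: map_key_inverse[OF assms] map_key_plus[symmetric] inj)
    then show "xcoeff (permute_vars \<pi> (f * g)) m = xcoeff (permute_vars \<pi> f * permute_vars \<pi> g) m"
      by (simp add: permute_vars_def xcoeff_mult)
  qed
next
  note inj = bij_is_inj[OF assms] bij_is_inj[OF bij_imp_bij_inv[OF assms]]
  have "Poly_Mapping.map_key \<pi> m = 0 \<longleftrightarrow> m = 0" for m :: "nat \<Rightarrow>\<^sub>0 nat"
    using map_key_inverse(2)[OF assms, of m] inj by (metis map_key_zero)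
  then show "permute_vars \<pi> 1 = 1"
    by (intro xseries_eqI) (simp add: permute_vars_def xcoeff_one)
qed (rule xseries_eqI; simp add: permute_vars_def)+

lemma bij_betw_vimage: "bij \<pi> \<Longrightarrow> bij_betw \<pi> (\<pi> -` S) S"
  by (rule bij_betw_imageI)
     (simp_all add: bij_is_surj surj_image_vimage_eq inj_on_subset[OF bij_is_inj])

lemma permute_vars_complete_sym:
  assumes "bij \<pi>"
  shows "permute_vars \<pi> (complete_sym r) = complete_sym r"
proof -
  have "monomial_degree (Poly_Mapping.map_key \<pi> m) = monomial_degree m" for m
  proof -
    have "(\<Sum>i\<in>\<pi> -` Poly_Mapping.keys m. Poly_Mapping.lookup m (\<pi> i)) = (\<Sum>i\<in>Poly_Mapping.keys m. Poly_Mapping.lookup m i)"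
      by (rule sum.reindex_bij_betw[OF bij_betw_vimage[OF assms]])
    then show ?thesis
      using assms by (simp add: monomial_degree_def bij_is_inj keys_map_key lookup_map_key)
  qed
  then show ?thesis
    by (intro xseries_eqI) (simp add: permute_vars_def xcoeff_complete_sym)
qed

lemma hom_det_mat:
  assumes "comm_ring_hom \<phi>"
  shows "\<phi> (det (mat n n (\<lambda>(i, j). A i j))) = det (mat n n (\<lambda>(i, j). \<phi> (A i j)))"
proof -
  interpret comm_ring_hom \<phi> by fact
  have "map_mat \<phi> (mat n n (\<lambda>(i, j). A i j)) = mat n n (\<lambda>(i, j). \<phi> (A i j))"
    by (rule eq_matI) auto
  with hom_det[of "mat n n (\<lambda>(i, j). A i j)"] show ?thesis by (simp only:)
qed

section \<open>The branching rule for Jacobi--Trudi determinants\<close>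

text \<open>The last row has no successor in the matrix; it is treated like the others by means of a
  virtual zero row at position \<open>l\<close>.\<close>

lemma det_subtract_next_row:
  fixes A :: "nat \<Rightarrow> nat \<Rightarrow> 'a :: comm_ring_1"
  assumes "\<And>j. j < l \<Longrightarrow> A l j = 0"
  shows "det (mat l l (\<lambda>(i, j). A i j - c i * A (Suc i) j)) = det (mat l l (\<lambda>(i, j). A i j))"
proof -
  define U where "U = mat l l (\<lambda>(i, k). if k = i then 1 else if k = Suc i then - c i else 0)"
  let ?M = "mat l l (\<lambda>(i, j). A i j)"
  have "U * ?M = mat l l (\<lambda>(i, j). A i j - c i * A (Suc i) j)"
  proof (rule eq_matI)
    fix i j assume "i < dim_row (mat l l (\<lambda>(i, j). A i j - c i * A (Suc i) j))"
      and "j < dim_col (mat l l (\<lambda>(i, j). A i j - c i * A (Suc i) j))"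
    then have ij: "i < l" "j < l" by simp_all
    have "(U * ?M) $$ (i, j)
        = (\<Sum>k<l. (if k = i then A i j else 0) + (if k = Suc i then - c i * A (Suc i) j else 0))"
      using ij by (auto simp: U_def times_mat_def scalar_prod_def atLeast0LessThan intro!: sum.cong)
    also have "\<dots> = A i j - (if Suc i < l then c i * A (Suc i) j else 0)"
      using ij by (auto simp: sum.distrib)
    also have "\<dots> = A i j - c i * A (Suc i) j"
      using ij assms[of j] by (cases "Suc i = l") auto
    finally show "(U * ?M) $$ (i, j) = mat l l (\<lambda>(i, j). A i j - c i * A (Suc i) j) $$ (i, j)"
      using ij by simp
  qed (simp_all add: U_def)
  moreover have "det U = prod_list (diag_mat U)"
    by (rule det_upper_triangular[of _ l]) (auto simp: U_def upper_triangular_def)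
  moreover have "prod_list (diag_mat U) = 1"
    by (simp add: prod_list_diag_prod U_def)
  moreover have "det (U * ?M) = det U * det ?M"
    by (rule det_mult[of _ l]) (simp_all add: U_def)
  ultimately show ?thesis by simp
qed

lemma det_multilinear_rows:
  fixes A :: "nat \<Rightarrow> 'k \<Rightarrow> nat \<Rightarrow> 'a :: comm_ring_1"
  assumes "\<And>i. i < l \<Longrightarrow> finite (K i)"
  shows "det (mat l l (\<lambda>(i, j). \<Sum>k\<in>K i. A i k j))
     = (\<Sum>f\<in>Pi\<^sub>E {..<l} K. det (mat l l (\<lambda>(i, j). A i (f i) j)))"
proof -
  have "det (mat l l (\<lambda>(i, j). \<Sum>k\<in>K i. A i k j))
      = (\<Sum>p | p permutes {..<l}. signof p * (\<Prod>i<l. \<Sum>k\<in>K i. A i k (p i)))"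
    unfolding det_def by (auto simp: atLeast0LessThan permutes_in_image intro!: sum.cong)
  also have "\<dots> = (\<Sum>p | p permutes {..<l}. \<Sum>f\<in>Pi\<^sub>E {..<l} K. signof p * (\<Prod>i<l. A i (f i) (p i)))"
    using assms by (subst prod_sum_PiE) (auto simp: sum_distrib_left)
  also have "\<dots> = (\<Sum>f\<in>Pi\<^sub>E {..<l} K. \<Sum>p | p permutes {..<l}. signof p * (\<Prod>i<l. A i (f i) (p i)))"
    by (rule sum.swap)
  also have "\<dots> = (\<Sum>f\<in>Pi\<^sub>E {..<l} K. det (mat l l (\<lambda>(i, j). A i (f i) j)))"
    unfolding det_def by (auto simp: atLeast0LessThan permutes_in_image intro!: sum.cong)
  finally show ?thesis .
qed

definition complete_upto :: "nat \<Rightarrow> int \<Rightarrow> xseries"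
  where "complete_upto n r = restrict_vars n (complete_sym r)"

lemma complete_upto_neg: "r < 0 \<Longrightarrow> complete_upto n r = 0"
  by (rule xseries_eqI) (simp add: complete_upto_def restrict_vars_def complete_sym_neg)

text \<open>A monomial of degree \<open>r\<close> either avoids the variable at position \<open>n\<close> or is divisible by it.\<close>

lemma complete_upto_Suc:
  "complete_upto (Suc n) r = complete_upto n r + xvar n * complete_upto (Suc n) (r - 1)"
proof (rule xseries_eqI)
  fix m
  show "xcoeff (complete_upto (Suc n) r) m
      = xcoeff (complete_upto n r + xvar n * complete_upto (Suc n) (r - 1)) m"
  proof (cases "Poly_Mapping.lookup m n = 0")
    case True
    then have "Poly_Mapping.keys m \<subseteq> {..<Suc n} \<longleftrightarrow> Poly_Mapping.keys m \<subseteq> {..<n}"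
      by (auto simp: lessThan_Suc in_keys_iff)
    with True show ?thesis
      by (simp add: complete_upto_def restrict_vars_def xcoeff_complete_sym xcoeff_xvar_mult)
  next
    case False
    define m' where "m' = m - Poly_Mapping.single n 1"
    have m: "m = m' + Poly_Mapping.single n 1"
      using False by (auto simp: m'_def poly_mapping_eq_iff fun_eq_iff lookup_add lookup_minus
          lookup_single when_def)
    have "\<not> Poly_Mapping.keys m \<subseteq> {..<n}"
      using False lookup_eq_0_of_keys[of m n n] by auto
    moreover have "Poly_Mapping.keys m \<subseteq> {..<Suc n} \<longleftrightarrow> Poly_Mapping.keys m' \<subseteq> {..<Suc n}"
      by (simp add: m keys_add_nat)
    moreover have "monomial_degree m = Suc (monomial_degree m')"
      unfolding m monomial_degree_add by (simp add: monomial_degree_def)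
    moreover have "m - Poly_Mapping.single n (Suc 0) = m'"
      by (simp add: m'_def)
    ultimately show ?thesis
      using False
      by (simp add: complete_upto_def restrict_vars_def xcoeff_complete_sym xcoeff_xvar_mult
          eq_diff_eq add.commute)
  qed
qed

text \<open>Iterating the recursion expresses \<open>h\<^sub>r\<close> in \<open>n + 1\<close> variables through \<open>h\<^sub>r, \<dots>, h\<^sub>r\<^sub>-\<^sub>d\<^sub>+\<^sub>1\<close> in \<open>n\<close>
  variables and a remainder. With \<open>d = \<lambda>\<^sub>i - \<lambda>\<^sub>i\<^sub>+\<^sub>1 + 1\<close> the remainder is a multiple of the
  entry below in the Jacobi--Trudi matrix, so that a row operation removes it.\<close>

lemma complete_upto_telescope:
  "complete_upto (Suc n) r - xvar n ^ d * complete_upto (Suc n) (r - int d)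
     = (\<Sum>k<d. xvar n ^ k * complete_upto n (r - int k))"
proof (induction d)
  case (Suc d)
  have "complete_upto (Suc n) (r - int d)
      = complete_upto n (r - int d) + xvar n * complete_upto (Suc n) (r - int (Suc d))"
    using complete_upto_Suc[of n "r - int d"] by (simp add: algebra_simps)
  with Suc show ?case by (simp add: algebra_simps)
qed simp

definition jacobi_trudi :: "nat \<Rightarrow> nat \<Rightarrow> (nat \<Rightarrow> nat) \<Rightarrow> xseries"
  where "jacobi_trudi n l lam =
    det (mat l l (\<lambda>(i, j). complete_upto n (int (lam i) + int j - int i)))"

text \<open>The virtual row at position \<open>l\<close> has the entries \<open>h\<^sub>j\<^sub>-\<^sub>l\<close> with \<open>j < l\<close>, which vanish as required by the
  row operation; this is where \<open>\<lambda>\<^sub>l = 0\<close> enters.\<close>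

lemma jacobi_trudi_branching_PiE:
  assumes "antimono lam" and "lam l = 0"
  shows "jacobi_trudi (Suc n) l lam
     = (\<Sum>\<mu>\<in>(\<Pi>\<^sub>E i\<in>{..<l}. {lam (Suc i)..lam i}).
          xvar n ^ (\<Sum>i<l. lam i - \<mu> i) * jacobi_trudi n l \<mu>)"
proof -
  define A where "A i j = complete_upto (Suc n) (int (lam i) + int j - int i)" for i j
  define c where "c i = xvar n ^ Suc (lam i - lam (Suc i))" for i
  have le: "lam (Suc i) \<le> lam i" for i
    using assms(1) by (simp add: antimonoD)
  have row: "A i j - c i * A (Suc i) j
     = (\<Sum>k\<in>{lam (Suc i)..lam i}. xvar n ^ (lam i - k) * complete_upto n (int k + int j - int i))" for i j
  proof -
    let ?r = "int (lam i) + int j - int i" and ?d = "Suc (lam i - lam (Suc i))"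
    have "int (lam (Suc i)) + int j - int (Suc i) = ?r - int ?d"
      using le[of i] by simp
    then have "A i j - c i * A (Suc i) j = (\<Sum>k<?d. xvar n ^ k * complete_upto n (?r - int k))"
      unfolding A_def c_def complete_upto_telescope[symmetric] by (simp only:)
    also have "\<dots> = (\<Sum>k\<in>{lam (Suc i)..lam i}. xvar n ^ (lam i - k) * complete_upto n (int k + int j - int i))"
      using le[of i]
      by (intro sum.reindex_bij_witness[of _ "\<lambda>k. lam i - k" "\<lambda>k. lam i - k"])
         (auto simp: of_nat_diff algebra_simps)
    finally show ?thesis .
  qed
  have "jacobi_trudi (Suc n) l lam = det (mat l l (\<lambda>(i, j). A i j - c i * A (Suc i) j))"
    unfolding jacobi_trudi_def A_def[symmetric]
    by (rule det_subtract_next_row[symmetric]) (simp add: A_def assms(2) complete_upto_neg)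
  also have "\<dots> = (\<Sum>\<mu>\<in>(\<Pi>\<^sub>E i\<in>{..<l}. {lam (Suc i)..lam i}).
      det (mat l l (\<lambda>(i, j). xvar n ^ (lam i - \<mu> i) * complete_upto n (int (\<mu> i) + int j - int i))))"
    unfolding row by (rule det_multilinear_rows) simp
  finally show ?thesis
    by (simp add: det_scale_rows jacobi_trudi_def power_sum)
qed

text \<open>The shapes \<open>\<mu>\<close> for which \<open>\<lambda>/\<mu>\<close> is a horizontal strip.\<close>

definition interlacing :: "(nat \<Rightarrow>\<^sub>0 nat) \<Rightarrow> (nat \<Rightarrow>\<^sub>0 nat) set"
  where "interlacing lam = {\<mu>. \<forall>i. Poly_Mapping.lookup lam (Suc i) \<le> Poly_Mapping.lookup \<mu> i
            \<and> Poly_Mapping.lookup \<mu> i \<le> Poly_Mapping.lookup lam i}"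

lemma interlacing_partition_seq:
  assumes "\<mu> \<in> interlacing lam"
  shows "partition_seq \<mu>"
proof -
  have "Poly_Mapping.lookup \<mu> (Suc i) \<le> Poly_Mapping.lookup \<mu> i" for i
    using assms unfolding interlacing_def by (metis (no_types, lifting) le_trans mem_Collect_eq)
  then show ?thesis
    unfolding partition_seq_def by (intro decseq_SucI)
qed

lemma interlacing_keys:
  "\<mu> \<in> interlacing lam \<Longrightarrow> Poly_Mapping.keys lam \<subseteq> A \<Longrightarrow> Poly_Mapping.keys \<mu> \<subseteq> A"
proof
  fix i assume \<mu>: "\<mu> \<in> interlacing lam" and A: "Poly_Mapping.keys lam \<subseteq> A" and "i \<in> Poly_Mapping.keys \<mu>"
  then have "0 < Poly_Mapping.lookup \<mu> i" by (simp add: in_keys_iff)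
  also have "\<dots> \<le> Poly_Mapping.lookup lam i" using \<mu> by (simp add: interlacing_def)
  finally have "i \<in> Poly_Mapping.keys lam" by (simp add: in_keys_iff)
  with A show "i \<in> A" by blast
qed

lemma interlacing_bij_betw:
  assumes "Poly_Mapping.keys lam \<subseteq> {..<l}"
  shows "bij_betw (\<lambda>\<mu>. restrict (Poly_Mapping.lookup \<mu>) {..<l}) (interlacing lam)
           (\<Pi>\<^sub>E i\<in>{..<l}. {Poly_Mapping.lookup lam (Suc i)..Poly_Mapping.lookup lam i})"
proof -
  have zero: "Poly_Mapping.lookup \<mu> i = 0" if "\<mu> = lam \<or> \<mu> \<in> interlacing lam" "\<not> i < l" for \<mu> i
    using that assms interlacing_keys[of \<mu> lam "{..<l}"] lookup_eq_0_of_keys[of \<mu> l i] by auto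
  show ?thesis
  proof (rule bij_betwI')
    fix \<mu> \<nu> assume "\<mu> \<in> interlacing lam" "\<nu> \<in> interlacing lam"
    then have "Poly_Mapping.lookup \<mu> i = Poly_Mapping.lookup \<nu> i"
      if "restrict (Poly_Mapping.lookup \<mu>) {..<l} = restrict (Poly_Mapping.lookup \<nu>) {..<l}" for i
      using fun_cong[OF that, of i] zero by (cases "i < l") auto
    then show "(restrict (Poly_Mapping.lookup \<mu>) {..<l} = restrict (Poly_Mapping.lookup \<nu>) {..<l}) = (\<mu> = \<nu>)"
      by (auto intro: poly_mapping_eqI)
  next
    fix \<mu> assume "\<mu> \<in> interlacing lam"
    then show "restrict (Poly_Mapping.lookup \<mu>) {..<l}
        \<in> (\<Pi>\<^sub>E i\<in>{..<l}. {Poly_Mapping.lookup lam (Suc i)..Poly_Mapping.lookup lam i})"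
      by (auto simp: interlacing_def)
  next
    fix f assume f: "f \<in> (\<Pi>\<^sub>E i\<in>{..<l}. {Poly_Mapping.lookup lam (Suc i)..Poly_Mapping.lookup lam i})"
    define \<mu> where "\<mu> = (\<Sum>i<l. Poly_Mapping.single i (f i))"
    have lookup: "Poly_Mapping.lookup \<mu> i = (if i < l then f i else 0)" for i
      by (simp add: \<mu>_def lookup_sum lookup_single when_def)
    have f_bounds: "Poly_Mapping.lookup lam (Suc i) \<le> f i \<and> f i \<le> Poly_Mapping.lookup lam i" if "i < l" for i
      using PiE_mem[OF f, of i] that by simp
    have "Poly_Mapping.lookup lam (Suc i) \<le> Poly_Mapping.lookup \<mu> i
        \<and> Poly_Mapping.lookup \<mu> i \<le> Poly_Mapping.lookup lam i" for i
      using f_bounds[of i] zero[of lam "Suc i"] by (cases "i < l") (simp_all add: lookup)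
    then have "\<mu> \<in> interlacing lam"
      by (simp add: interlacing_def)
    moreover have "f = restrict (Poly_Mapping.lookup \<mu>) {..<l}"
      using PiE_arb[OF f] by (auto simp: fun_eq_iff lookup)
    ultimately show "\<exists>\<mu>\<in>interlacing lam. f = restrict (Poly_Mapping.lookup \<mu>) {..<l}" by blast
  qed
qed

lemma finite_interlacing: "finite (interlacing lam)"
proof -
  obtain l where "Poly_Mapping.keys lam \<subseteq> {..<l}"
    using finite_nat_iff_bounded finite_keys by blast
  from bij_betw_finite[OF interlacing_bij_betw[OF this]] show ?thesis
    by (simp add: finite_PiE)
qed

lemma jacobi_trudi_cong:
  "(\<And>i. i < l \<Longrightarrow> \<mu> i = \<nu> i) \<Longrightarrow> jacobi_trudi n l \<mu> = jacobi_trudi n l \<nu>"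
  unfolding jacobi_trudi_def by (intro arg_cong[where f = det] cong_mat) auto

lemma jacobi_trudi_branching:
  assumes "partition_seq lam" and "Poly_Mapping.keys lam \<subseteq> {..<l}"
  shows "jacobi_trudi (Suc n) l (Poly_Mapping.lookup lam)
     = (\<Sum>\<mu>\<in>interlacing lam. xvar n ^ (\<Sum>i<l. Poly_Mapping.lookup lam i - Poly_Mapping.lookup \<mu> i)
          * jacobi_trudi n l (Poly_Mapping.lookup \<mu>))"
proof -
  have "Poly_Mapping.lookup lam l = 0"
    using assms(2) by (rule lookup_eq_0_of_keys) simp
  then have "jacobi_trudi (Suc n) l (Poly_Mapping.lookup lam)
     = (\<Sum>f\<in>(\<Pi>\<^sub>E i\<in>{..<l}. {Poly_Mapping.lookup lam (Suc i)..Poly_Mapping.lookup lam i}).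
          xvar n ^ (\<Sum>i<l. Poly_Mapping.lookup lam i - f i) * jacobi_trudi n l f)"
    using assms(1) by (intro jacobi_trudi_branching_PiE) (simp_all add: partition_seq_def)
  also have "\<dots> = (\<Sum>\<mu>\<in>interlacing lam.
      xvar n ^ (\<Sum>i<l. Poly_Mapping.lookup lam i - restrict (Poly_Mapping.lookup \<mu>) {..<l} i)
        * jacobi_trudi n l (restrict (Poly_Mapping.lookup \<mu>) {..<l}))"
    by (rule sum.reindex_bij_betw[OF interlacing_bij_betw[OF assms(2)], symmetric])
  also have "\<dots> = (\<Sum>\<mu>\<in>interlacing lam. xvar n ^ (\<Sum>i<l. Poly_Mapping.lookup lam i - Poly_Mapping.lookup \<mu> i)
          * jacobi_trudi n l (Poly_Mapping.lookup \<mu>))"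
    by (intro sum.cong refl arg_cong2[where f = "(*)"] jacobi_trudi_cong) simp_all
  finally show ?thesis .
qed

text \<open>Without variables \<open>h\<^sub>r\<close> is \<open>1\<close> for \<open>r = 0\<close> and vanishes otherwise. A nonzero entry
  satisfies \<open>j = i - \<lambda>\<^sub>i \<le> i\<close>, so the matrix is lower triangular.\<close>

lemma jacobi_trudi_no_vars:
  "jacobi_trudi 0 l lam = (if \<forall>i<l. lam i = 0 then 1 else 0)"
proof -
  have entry: "complete_upto 0 r = (if r = 0 then 1 else 0)" for r
    by (rule xseries_eqI)
       (auto simp: complete_upto_def restrict_vars_def xcoeff_complete_sym xcoeff_one monomial_degree_def)
  define M where "M = mat l l (\<lambda>(i, j). complete_upto 0 (int (lam i) + int j - int i))"
  have "det M = prod_list (diag_mat M)"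
    by (rule det_lower_triangular[of l]) (auto simp: M_def entry)
  also have "\<dots> = (\<Prod>i<l. if lam i = 0 then 1 else 0)"
    by (simp add: prod_list_diag_prod M_def entry atLeast0LessThan)
  also have "\<dots> = (if \<forall>i<l. lam i = 0 then 1 else 0)"
    by (auto intro!: prod_zero)
  finally show ?thesis
    by (simp add: jacobi_trudi_def M_def)
qed

section \<open>The branching rule for tableaux\<close>

definition tableaux_le :: "nat \<Rightarrow> (nat \<Rightarrow>\<^sub>0 nat) \<Rightarrow> (nat \<times> nat \<Rightarrow> nat) set"
  where "tableaux_le n lam = {T \<in> tableaux lam. \<forall>b\<in>young_diagram lam. T b \<le> n}"

lemma finite_tableaux_le: "finite (tableaux_le n lam)"
proof (rule finite_subset)
  show "tableaux_le n lam \<subseteq> (\<Pi>\<^sub>E b\<in>young_diagram lam. {..n})"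
    by (auto simp: tableaux_le_def tableaux_def PiE_iff extensional_def)
qed (simp add: finite_PiE finite_young_diagram)

text \<open>The only filling of the empty diagram is the function that is undefined everywhere.\<close>

lemma tableaux_le_0: "tableaux_le 0 lam = (if lam = 0 then {\<lambda>b. undefined} else {})"
proof (cases "lam = 0")
  case True
  then have "young_diagram lam = {}" by (simp add: young_diagram_def)
  then show ?thesis using True by (auto simp: tableaux_le_def tableaux_def)
next
  case False
  then obtain i where "Poly_Mapping.lookup lam i \<noteq> 0"
    by (auto simp: poly_mapping_eq_iff fun_eq_iff)
  then have "(i, 0) \<in> young_diagram lam" by (simp add: young_diagram_def)
  then have "tableaux_le 0 lam = {}"
    by (fastforce simp: tableaux_le_def tableaux_def PiE_iff)
  with False show ?thesis by simp
qed

lemma young_diagram_mono: "\<mu> \<in> interlacing lam \<Longrightarrow> young_diagram \<mu> \<subseteq> young_diagram lam"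
  by (force simp: young_diagram_def interlacing_def intro: less_le_trans)

lemma young_diagram_inj: "young_diagram lam = young_diagram \<mu> \<Longrightarrow> lam = \<mu>"
proof (rule poly_mapping_eqI)
  fix i assume "young_diagram lam = young_diagram \<mu>"
  then have "j < Poly_Mapping.lookup lam i \<longleftrightarrow> j < Poly_Mapping.lookup \<mu> i" for j
    by (auto simp: young_diagram_def set_eq_iff)
  then show "Poly_Mapping.lookup lam i = Poly_Mapping.lookup \<mu> i"
    by (metis less_irrefl linorder_neqE_nat)
qed

definition fill_strip :: "nat \<Rightarrow> (nat \<Rightarrow>\<^sub>0 nat) \<Rightarrow> (nat \<Rightarrow>\<^sub>0 nat) \<Rightarrow> (nat \<times> nat \<Rightarrow> nat) \<Rightarrow> nat \<times> nat \<Rightarrow> nat"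
  where "fill_strip n lam \<mu> T =
    (\<lambda>b\<in>young_diagram lam. if b \<in> young_diagram \<mu> then T b else Suc n)"

lemma fill_strip_tableau:
  assumes \<mu>: "\<mu> \<in> interlacing lam" and T: "T \<in> tableaux_le n \<mu>"
  shows "fill_strip n lam \<mu> T \<in> tableaux_le (Suc n) lam"
proof -
  let ?G = "fill_strip n lam \<mu> T"
  have T_le: "1 \<le> T b \<and> T b \<le> n" if "b \<in> young_diagram \<mu>" for b
    using T that by (auto simp: tableaux_le_def tableaux_def PiE_iff)
  have range: "1 \<le> ?G b \<and> ?G b \<le> Suc n" if "b \<in> young_diagram lam" for b
    using that T_le[of b] by (auto simp: fill_strip_def)
  have rows: "?G (i, j) \<le> ?G (i, j')"
    if "(i, j) \<in> young_diagram lam" "(i, j') \<in> young_diagram lam" "j < j'" for i j j'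
  proof (cases "(i, j') \<in> young_diagram \<mu>")
    case True
    with that have "(i, j) \<in> young_diagram \<mu>" by (auto simp: young_diagram_def)
    with True that T show ?thesis by (simp add: fill_strip_def tableaux_le_def tableaux_def)
  next
    case False
    then show ?thesis using that range[of "(i, j)"] by (simp add: fill_strip_def)
  qed
  have cols: "?G (i, j) < ?G (i', j)"
    if "(i, j) \<in> young_diagram lam" "(i', j) \<in> young_diagram lam" "i < i'" for i i' j
  proof -
    have "(i, j) \<in> young_diagram \<mu>"
    proof -
      \<comment> \<open>A strip has at most one box in each column: \<open>\<lambda>\<^sub>i\<^sub>' \<le> \<mu>\<^sub>i\<^sub>'\<^sub>-\<^sub>1 \<le> \<mu>\<^sub>i\<close>.\<close>
      have "Poly_Mapping.lookup lam i' \<le> Poly_Mapping.lookup \<mu> (i' - 1)"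
        using \<mu> that(3) by (cases i') (auto simp: interlacing_def)
      also have "\<dots> \<le> Poly_Mapping.lookup \<mu> i"
        using interlacing_partition_seq[OF \<mu>] that(3) by (auto simp: partition_seq_def intro: antimonoD)
      finally show ?thesis using that(2) by (auto simp: young_diagram_def)
    qed
    with that T T_le[of "(i, j)"] show ?thesis
      by (auto simp: fill_strip_def tableaux_le_def tableaux_def)
  qed
  show ?thesis
    using range rows cols by (auto simp: tableaux_le_def tableaux_def fill_strip_def)
qed

text \<open>The shape of the boxes with entries at most \<open>n\<close>; rows being weakly increasing, these are
  initial segments of the rows, so it suffices to count them.\<close>

lift_definition inner_shape :: "nat \<Rightarrow> (nat \<Rightarrow>\<^sub>0 nat) \<Rightarrow> (nat \<times> nat \<Rightarrow> nat) \<Rightarrow> (nat \<Rightarrow>\<^sub>0 nat)"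
  is "\<lambda>n lam T i. card {j. j < lam i \<and> T (i, j) \<le> n}"
proof -
  fix n :: nat and lam :: "nat \<Rightarrow> nat" and T :: "nat \<times> nat \<Rightarrow> nat"
  assume "finite {i. lam i \<noteq> 0}"
  then show "finite {i. card {j. j < lam i \<and> T (i, j) \<le> n} \<noteq> 0}"
    by (rule rev_finite_subset) (auto simp: card_gt_0_iff)
qed

lemma mem_down_set_iff_less_card:
  fixes S :: "nat set"
  assumes "finite S" and down: "\<And>i j. j \<in> S \<Longrightarrow> i < j \<Longrightarrow> i \<in> S"
  shows "i \<in> S \<longleftrightarrow> i < card S"
proof
  assume "i \<in> S"
  then have "{..i} \<subseteq> S" using down by (auto simp: le_less)
  from card_mono[OF \<open>finite S\<close> this] show "i < card S" by simp
next
  assume "i < card S"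
  then have "\<not> S \<subseteq> {..<i}" using card_mono[of "{..<i}" S] by auto
  then obtain j where "j \<in> S" "i \<le> j" by (meson lessThan_iff not_le subsetI)
  then show "i \<in> S" using down by (auto simp: le_less)
qed

lemma young_diagram_inner_shape:
  assumes T: "T \<in> tableaux lam"
  shows "young_diagram (inner_shape n lam T) = {b \<in> young_diagram lam. T b \<le> n}"
proof -
  have "j < card {j. j < Poly_Mapping.lookup lam i \<and> T (i, j) \<le> n}
      \<longleftrightarrow> j < Poly_Mapping.lookup lam i \<and> T (i, j) \<le> n" for i j
  proof -
    let ?S = "{j. j < Poly_Mapping.lookup lam i \<and> T (i, j) \<le> n}"
    have down: "j \<in> ?S" if "j' \<in> ?S" "j < j'" for j j'
    proof -
      have "T (i, j) \<le> T (i, j')"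
        using T that by (auto simp: tableaux_def young_diagram_def)
      with that show ?thesis by auto
    qed
    have "finite ?S" by simp
    from mem_down_set_iff_less_card[where i = j, OF this down] show ?thesis by auto
  qed
  then show ?thesis
    by (auto simp: young_diagram_def inner_shape.rep_eq)
qed

text \<open>If the boxes with entry \<open>n + 1\<close> were not a horizontal strip, row \<open>i + 1\<close> would reach below the
  first entry \<open>n + 1\<close> of row \<open>i\<close> and would need a larger entry there.\<close>

lemma inner_shape_interlacing:
  assumes lam: "partition_seq lam" and T: "T \<in> tableaux_le (Suc n) lam"
  shows "inner_shape n lam T \<in> interlacing lam"
proof -
  let ?\<mu> = "inner_shape n lam T"
  have Y: "young_diagram ?\<mu> = {b \<in> young_diagram lam. T b \<le> n}"
    using T by (intro young_diagram_inner_shape) (simp add: tableaux_le_def)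
  have "Poly_Mapping.lookup lam (Suc i) \<le> Poly_Mapping.lookup ?\<mu> i" for i
  proof (rule ccontr)
    assume "\<not> ?thesis"
    then have 1: "(Suc i, Poly_Mapping.lookup ?\<mu> i) \<in> young_diagram lam"
      by (simp add: young_diagram_def)
    moreover have "Poly_Mapping.lookup lam (Suc i) \<le> Poly_Mapping.lookup lam i"
      using lam by (simp add: partition_seq_def antimonoD)
    ultimately have 2: "(i, Poly_Mapping.lookup ?\<mu> i) \<in> young_diagram lam"
      by (simp add: young_diagram_def)
    have "T (i, Poly_Mapping.lookup ?\<mu> i) < T (Suc i, Poly_Mapping.lookup ?\<mu> i)"
      using T 1 2 by (simp add: tableaux_le_def tableaux_def)
    also have "\<dots> \<le> Suc n" using T 1 by (simp add: tableaux_le_def)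
    finally have "(i, Poly_Mapping.lookup ?\<mu> i) \<in> young_diagram ?\<mu>"
      using 2 unfolding Y by simp
    then show False by (simp add: young_diagram_def)
  qed
  moreover have "Poly_Mapping.lookup ?\<mu> i \<le> Poly_Mapping.lookup lam i" for i
    unfolding inner_shape.rep_eq
    by (rule order.trans[OF card_mono[of "{..<Poly_Mapping.lookup lam i}"]]) auto
  ultimately show ?thesis by (simp add: interlacing_def)
qed

lemma restrict_inner_tableau:
  assumes T: "T \<in> tableaux lam"
  shows "restrict T (young_diagram (inner_shape n lam T)) \<in> tableaux_le n (inner_shape n lam T)"
  using T by (auto simp: young_diagram_inner_shape tableaux_le_def tableaux_def PiE_iff)

lemma fill_strip_restrict:
  assumes T: "T \<in> tableaux_le (Suc n) lam"
  shows "fill_strip n lam (inner_shape n lam T) (restrict T (young_diagram (inner_shape n lam T))) = T"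
proof -
  have Y: "young_diagram (inner_shape n lam T) = {b \<in> young_diagram lam. T b \<le> n}"
    using T by (intro young_diagram_inner_shape) (simp add: tableaux_le_def)
  show ?thesis
  proof
    fix b
    show "fill_strip n lam (inner_shape n lam T) (restrict T (young_diagram (inner_shape n lam T))) b = T b"
    proof (cases "b \<in> young_diagram lam")
      case True
      moreover have "T b \<le> Suc n" using T True by (simp add: tableaux_le_def)
      ultimately show ?thesis by (auto simp: fill_strip_def Y)
    next
      case False
      have "T \<in> young_diagram lam \<rightarrow>\<^sub>E {1..}"
        using T by (simp add: tableaux_le_def tableaux_def)
      from PiE_arb[OF this False] show ?thesis using False by (simp add: fill_strip_def)
    qed
  qed
qed

lemma inner_shape_fill_strip:
  assumes \<mu>: "\<mu> \<in> interlacing lam" and T: "T \<in> tableaux_le n \<mu>"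
  shows "inner_shape n lam (fill_strip n lam \<mu> T) = \<mu>"
    and "restrict (fill_strip n lam \<mu> T) (young_diagram \<mu>) = T"
proof -
  have "fill_strip n lam \<mu> T \<in> tableaux lam"
    using fill_strip_tableau[OF \<mu> T] by (simp add: tableaux_le_def)
  then have "young_diagram (inner_shape n lam (fill_strip n lam \<mu> T))
      = {b \<in> young_diagram lam. fill_strip n lam \<mu> T b \<le> n}"
    by (rule young_diagram_inner_shape)
  also have "\<dots> = young_diagram \<mu>"
    using young_diagram_mono[OF \<mu>] T by (auto simp: fill_strip_def tableaux_le_def)
  finally show "inner_shape n lam (fill_strip n lam \<mu> T) = \<mu>"
    by (rule young_diagram_inj)
  have "T \<in> young_diagram \<mu> \<rightarrow>\<^sub>E {1..}"
    using T by (simp add: tableaux_le_def tableaux_def)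
  then have "T = restrict T (young_diagram \<mu>)"
    by (metis PiE_restrict)
  also have "\<dots> = restrict (fill_strip n lam \<mu> T) (young_diagram \<mu>)"
    using young_diagram_mono[OF \<mu>] by (intro restrict_ext) (auto simp: fill_strip_def)
  finally show "restrict (fill_strip n lam \<mu> T) (young_diagram \<mu>) = T" ..
qed

lemma young_diagram_Sigma:
  "Poly_Mapping.keys lam \<subseteq> {..<l} \<Longrightarrow> young_diagram lam = Sigma {..<l} (\<lambda>i. {..<Poly_Mapping.lookup lam i})"
  by (auto simp: young_diagram_def in_keys_iff subset_eq)

text \<open>The added boxes are exactly those of \<open>\<lambda>/\<mu>\<close>, and their entry \<open>n + 1\<close> is counted at
  position \<open>n\<close> of the content.\<close>

lemma tableau_content_fill_strip:
  assumes \<mu>: "\<mu> \<in> interlacing lam" and T: "T \<in> tableaux_le n \<mu>"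
    and l: "Poly_Mapping.keys lam \<subseteq> {..<l}"
  shows "tableau_content lam (fill_strip n lam \<mu> T) = tableau_content \<mu> T
     + Poly_Mapping.single n (\<Sum>i<l. Poly_Mapping.lookup lam i - Poly_Mapping.lookup \<mu> i)"
proof (rule poly_mapping_eqI)
  fix k
  let ?G = "fill_strip n lam \<mu> T"
  have sub: "young_diagram \<mu> \<subseteq> young_diagram lam" by (rule young_diagram_mono[OF \<mu>])
  have inner: "{b \<in> young_diagram \<mu>. ?G b = Suc k} = {b \<in> young_diagram \<mu>. T b = Suc k}"
    using sub by (auto simp: fill_strip_def)
  have outer: "{b \<in> young_diagram lam - young_diagram \<mu>. ?G b = Suc k}
      = (if k = n then young_diagram lam - young_diagram \<mu> else {})"
    by (auto simp: fill_strip_def)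
  have "card {b \<in> young_diagram lam. ?G b = Suc k}
      = card ({b \<in> young_diagram \<mu>. ?G b = Suc k} \<union> {b \<in> young_diagram lam - young_diagram \<mu>. ?G b = Suc k})"
    using sub by (intro arg_cong[where f = card]) auto
  also have "\<dots> = card {b \<in> young_diagram \<mu>. ?G b = Suc k}
      + card {b \<in> young_diagram lam - young_diagram \<mu>. ?G b = Suc k}"
    by (rule card_Un_disjoint) (auto simp: finite_young_diagram)
  also have "\<dots> = card {b \<in> young_diagram \<mu>. T b = Suc k}
      + (if k = n then card (young_diagram lam - young_diagram \<mu>) else 0)"
    unfolding inner outer by simp
  also have "card (young_diagram lam - young_diagram \<mu>)
      = (\<Sum>i<l. Poly_Mapping.lookup lam i - Poly_Mapping.lookup \<mu> i)"
  proof -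
    have "card (young_diagram lam - young_diagram \<mu>) = card (young_diagram lam) - card (young_diagram \<mu>)"
      using sub by (simp add: card_Diff_subset finite_young_diagram)
    also have "\<dots> = (\<Sum>i<l. Poly_Mapping.lookup lam i) - (\<Sum>i<l. Poly_Mapping.lookup \<mu> i)"
      by (simp add: young_diagram_Sigma[OF l] young_diagram_Sigma[OF interlacing_keys[OF \<mu> l]])
    also have "\<dots> = (\<Sum>i<l. Poly_Mapping.lookup lam i - Poly_Mapping.lookup \<mu> i)"
      using \<mu> by (intro sum_subtractf_nat[symmetric]) (simp add: interlacing_def)
    finally show ?thesis .
  qed
  finally show "Poly_Mapping.lookup (tableau_content lam ?G) k = Poly_Mapping.lookup (tableau_content \<mu> T
     + Poly_Mapping.single n (\<Sum>i<l. Poly_Mapping.lookup lam i - Poly_Mapping.lookup \<mu> i)) k"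
    by (simp add: tableau_content.rep_eq lookup_add lookup_single when_def)
qed

text \<open>Filling the strip \<open>\<lambda>/\<mu>\<close> with \<open>n + 1\<close> and discarding the entries \<open>n + 1\<close> are inverse
  bijections between pairs \<open>(\<mu>, T)\<close> and tableaux of shape \<open>\<lambda>\<close>.\<close>

lemma tableaux_branching:
  assumes lam: "partition_seq lam" and l: "Poly_Mapping.keys lam \<subseteq> {..<l}"
  shows "(\<Sum>T\<in>tableaux_le (Suc n) lam. xpow (tableau_content lam T))
     = (\<Sum>\<mu>\<in>interlacing lam. xvar n ^ (\<Sum>i<l. Poly_Mapping.lookup lam i - Poly_Mapping.lookup \<mu> i)
          * (\<Sum>T\<in>tableaux_le n \<mu>. xpow (tableau_content \<mu> T)))"
proof -
  let ?w = "\<lambda>\<mu> T. xvar n ^ (\<Sum>i<l. Poly_Mapping.lookup lam i - Poly_Mapping.lookup \<mu> i)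
               * xpow (tableau_content \<mu> T)"
  have "(\<Sum>T\<in>tableaux_le (Suc n) lam. xpow (tableau_content lam T))
      = (\<Sum>(\<mu>, T)\<in>Sigma (interlacing lam) (tableaux_le n). ?w \<mu> T)"
  proof (rule sum.reindex_bij_witness[of _ "\<lambda>(\<mu>, T). fill_strip n lam \<mu> T"
        "\<lambda>T. (inner_shape n lam T, restrict T (young_diagram (inner_shape n lam T)))"])
    fix T assume T: "T \<in> tableaux_le (Suc n) lam"
    let ?\<mu> = "inner_shape n lam T" and ?T = "restrict T (young_diagram (inner_shape n lam T))"
    from T have "T \<in> tableaux lam" by (simp add: tableaux_le_def)
    then have mem: "?\<mu> \<in> interlacing lam" "?T \<in> tableaux_le n ?\<mu>"
      by (simp_all add: inner_shape_interlacing[OF lam T] restrict_inner_tableau)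
    then show "(?\<mu>, ?T) \<in> Sigma (interlacing lam) (tableaux_le n)" by simp
    show "(case (?\<mu>, ?T) of (\<mu>, T) \<Rightarrow> fill_strip n lam \<mu> T) = T"
      by (simp add: fill_strip_restrict T)
    show "(case (?\<mu>, ?T) of (\<mu>, T) \<Rightarrow> ?w \<mu> T) = xpow (tableau_content lam T)"
      using tableau_content_fill_strip[OF mem l] unfolding fill_strip_restrict[OF T]
      by (simp add: xpow_add xvar_power_eq_xpow mult.commute)
  qed (auto simp: inner_shape_fill_strip fill_strip_tableau)
  also have "\<dots> = (\<Sum>\<mu>\<in>interlacing lam. \<Sum>T\<in>tableaux_le n \<mu>. ?w \<mu> T)"
    by (rule sum.Sigma[symmetric]) (simp_all add: finite_interlacing finite_tableaux_le)
  finally show ?thesis by (simp add: sum_distrib_left)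
qed

section \<open>Coefficients of Schur functions\<close>

theorem jacobi_trudi_eq_sum_tableaux:
  assumes "partition_seq lam" and "Poly_Mapping.keys lam \<subseteq> {..<l}"
  shows "jacobi_trudi n l (Poly_Mapping.lookup lam) = (\<Sum>T\<in>tableaux_le n lam. xpow (tableau_content lam T))"
  using assms
proof (induction n arbitrary: lam)
  case 0
  have "(\<forall>i<l. Poly_Mapping.lookup lam i = 0) \<longleftrightarrow> lam = 0"
    using lookup_eq_0_of_keys[OF 0(2)] by (metis lookup_zero not_le poly_mapping_eqI)
  moreover have "tableau_content 0 T = 0" for T
    by (rule poly_mapping_eqI) (simp add: tableau_content.rep_eq young_diagram_def)
  ultimately show ?case
    by (simp add: jacobi_trudi_no_vars tableaux_le_0 xpow_def)
next
  case (Suc n)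
  have "jacobi_trudi n l (Poly_Mapping.lookup \<mu>) = (\<Sum>T\<in>tableaux_le n \<mu>. xpow (tableau_content \<mu> T))"
    if "\<mu> \<in> interlacing lam" for \<mu>
    using that interlacing_keys[OF that Suc.prems(2)] by (intro Suc.IH interlacing_partition_seq)
  then show ?case
    by (simp add: jacobi_trudi_branching[OF Suc.prems] tableaux_branching[OF Suc.prems])
qed

lemma schur_partition_eq_det:
  assumes "Poly_Mapping.keys lam \<subseteq> {..<l}"
  shows "schur (Poly_Mapping.map int lam)
    = det (mat l l (\<lambda>(i, j). complete_sym (int (Poly_Mapping.lookup lam i) + int j - int i)))"
proof -
  have lookup: "Poly_Mapping.lookup (Poly_Mapping.map int lam) i = int (Poly_Mapping.lookup lam i)" for i
    by (simp add: Poly_Mapping.map.rep_eq when_def)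
  have "Poly_Mapping.keys (Poly_Mapping.map int lam) \<subseteq> {..<l}"
    using assms by (auto simp: in_keys_iff lookup subset_eq)
  from schur_eq_det[OF this] show ?thesis by (simp add: lookup)
qed

lemma restrict_vars_schur:
  assumes "partition_seq lam"
  shows "restrict_vars n (schur (Poly_Mapping.map int lam))
     = (\<Sum>T\<in>tableaux_le n lam. xpow (tableau_content lam T))"
proof -
  obtain l where l: "Poly_Mapping.keys lam \<subseteq> {..<l}"
    using finite_nat_iff_bounded finite_keys by blast
  show ?thesis
    unfolding schur_partition_eq_det[OF l] hom_det_mat[OF restrict_vars_hom]
    by (simp add: jacobi_trudi_eq_sum_tableaux[OF assms l, symmetric] jacobi_trudi_def complete_upto_def)
qed

text \<open>The content determines which entries occur, so tableaux of given content have bounded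
  entries.\<close>

lemma tableaux_with_content:
  assumes "Poly_Mapping.keys m \<subseteq> {..<n}"
  shows "{T \<in> tableaux lam. tableau_content lam T = m} = {T \<in> tableaux_le n lam. tableau_content lam T = m}"
proof -
  have "T b \<le> n" if "T \<in> tableaux lam" "tableau_content lam T = m" "b \<in> young_diagram lam" for T b
  proof -
    have "1 \<le> T b" using that by (auto simp: tableaux_def PiE_iff)
    then have "b \<in> {b' \<in> young_diagram lam. T b' = Suc (T b - 1)}" using that by simp
    moreover have "finite {b' \<in> young_diagram lam. T b' = Suc (T b - 1)}"
      by (simp add: finite_young_diagram)
    ultimately have "card {b' \<in> young_diagram lam. T b' = Suc (T b - 1)} \<noteq> 0"
      by (metis card_0_eq empty_iff)
    then have "Poly_Mapping.lookup m (T b - 1) \<noteq> 0"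
      by (simp only: that(2)[symmetric] tableau_content.rep_eq not_False_eq_True)
    then have "T b - 1 < n" using lookup_eq_0_of_keys[OF assms, of "T b - 1"] by linarith
    then show ?thesis by simp
  qed
  then show ?thesis by (auto simp: tableaux_le_def)
qed

lemma finite_tableaux_with_content: "finite {T \<in> tableaux lam. tableau_content lam T = m}"
proof -
  obtain n where "Poly_Mapping.keys m \<subseteq> {..<n}"
    using finite_nat_iff_bounded finite_keys by blast
  then show ?thesis by (simp add: tableaux_with_content finite_tableaux_le)
qed

text \<open>Here \<open>m\<close> need not be a partition; this generality is what allows the symmetry of the
  numbers \<open>K\<^sub>\<lambda>\<^sub>,\<^sub>m\<close> to be read off from that of \<open>s\<^sub>\<lambda>\<close>.\<close>

lemma xcoeff_schur:
  assumes "partition_seq lam"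
  shows "xcoeff (schur (Poly_Mapping.map int lam)) m = int (kostka lam m)"
proof -
  obtain n where n: "Poly_Mapping.keys m \<subseteq> {..<n}"
    using finite_nat_iff_bounded finite_keys by blast
  have "xcoeff (schur (Poly_Mapping.map int lam)) m
      = xcoeff (restrict_vars n (schur (Poly_Mapping.map int lam))) m"
    using n by (simp add: restrict_vars_def)
  also have "\<dots> = (\<Sum>T\<in>tableaux_le n lam. if tableau_content lam T = m then 1 else 0)"
    by (simp add: restrict_vars_schur[OF assms] xpow_eq eq_commute)
  also have "\<dots> = int (card {T \<in> tableaux_le n lam. tableau_content lam T = m})"
    by (simp add: finite_tableaux_le flip: sum.inter_filter)
  finally show ?thesis by (simp add: kostka_def tableaux_with_content[OF n])
qed

text \<open>This would otherwise call for the Bender--Knuth involutions; here it follows from the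
  determinant, all of whose entries are symmetric.\<close>

lemma kostka_rearrangement:
  assumes lam: "partition_seq lam" and "\<alpha> \<in> rearrangements \<mu>"
  shows "kostka lam \<alpha> = kostka lam \<mu>"
proof -
  obtain \<pi> where \<pi>: "bij \<pi>" and "Poly_Mapping.lookup \<alpha> = Poly_Mapping.lookup \<mu> \<circ> \<pi>"
    using assms(2) by (auto simp: rearrangements_def)
  then have \<alpha>: "\<alpha> = Poly_Mapping.map_key \<pi> \<mu>"
    by (intro poly_mapping_eqI) (simp add: lookup_map_key bij_is_inj)
  obtain l where l: "Poly_Mapping.keys lam \<subseteq> {..<l}"
    using finite_nat_iff_bounded finite_keys by blast
  let ?s = "schur (Poly_Mapping.map int lam)"
  have "permute_vars \<pi> ?s = ?s"
    unfolding schur_partition_eq_det[OF l] hom_det_mat[OF permute_vars_hom[OF \<pi>]]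
    by (simp add: permute_vars_complete_sym[OF \<pi>])
  then have "xcoeff ?s \<mu> = xcoeff ?s \<alpha>"
    unfolding \<alpha> by (metis permute_vars_def xcoeff_Xseries)
  then show ?thesis by (simp add: xcoeff_schur[OF lam])
qed

section \<open>Rearrangement classes and the two expansions\<close>

text \<open>The nonzero exponents lie in an initial segment of the positions, which is sorted; the sorting
  permutation extends by the identity.\<close>

lemma ex_partition_rearrangement: "\<exists>\<mu>. partition_seq \<mu> \<and> m \<in> rearrangements \<mu>"
proof -
  obtain N where N: "Poly_Mapping.keys m \<subseteq> {..<N}"
    using finite_nat_iff_bounded finite_keys by blast
  define xs where "xs = map (Poly_Mapping.lookup m) [0..<N]"
  define ys where "ys = rev (sort xs)"
  have len: "length ys = N" by (simp add: ys_def xs_def)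
  have "mset xs = mset ys" by (simp add: ys_def)
  then obtain p where p: "p permutes {..<N}" "permute_list p ys = xs"
    by (rule mset_eq_permutation) (simp_all add: len)
  define \<mu> where "\<mu> = (\<Sum>i<N. Poly_Mapping.single i (ys ! i))"
  have lookup: "Poly_Mapping.lookup \<mu> i = (if i < N then ys ! i else 0)" for i
    by (simp add: \<mu>_def lookup_sum lookup_single when_def)
  have "sorted_wrt (\<ge>) ys" by (simp add: ys_def sorted_wrt_rev)
  then have "partition_seq \<mu>"
    unfolding partition_seq_def
    by (intro antimonoI) (auto simp: lookup len sorted_wrt_iff_nth_less le_less)
  moreover have "Poly_Mapping.lookup m i = Poly_Mapping.lookup \<mu> (p i)" for i
  proof (cases "i < N")
    case True
    then have "Poly_Mapping.lookup m i = permute_list p ys ! i" by (simp add: p(2) xs_def)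
    also have "\<dots> = ys ! p i" using p(1) True by (simp add: permute_list_nth len)
    finally show ?thesis using permutes_in_image[OF p(1), of i] True by (simp add: lookup)
  next
    case False
    then have "p i = i" "Poly_Mapping.lookup m i = 0"
      using permutes_not_in[OF p(1)] lookup_eq_0_of_keys[OF N] by auto
    with False show ?thesis by (simp add: lookup)
  qed
  then have "m \<in> rearrangements \<mu>"
    using permutes_bij[OF p(1)] by (auto simp: rearrangements_def fun_eq_iff)
  ultimately show ?thesis by blast
qed

lemma partition_seq_less_iff:
  assumes "partition_seq \<mu>"
  shows "t < Poly_Mapping.lookup \<mu> i \<longleftrightarrow> i < card {k. t < Poly_Mapping.lookup \<mu> k}"
proof -
  let ?S = "{k. t < Poly_Mapping.lookup \<mu> k}"
  have fin: "finite ?S"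
    by (rule finite_subset[of _ "Poly_Mapping.keys \<mu>"]) (auto simp: in_keys_iff)
  have down: "k \<in> ?S" if "k' \<in> ?S" "k < k'" for k k'
    using antimonoD[of "Poly_Mapping.lookup \<mu>" k k'] assms that by (simp add: partition_seq_def)
  show ?thesis
    using mem_down_set_iff_less_card[where i = i, OF fin down] by simp
qed

text \<open>A partition is determined by its conjugate, the numbers \<open>card {k. t < \<mu>\<^sub>k}\<close>, and these
  are invariant under rearrangement.\<close>

lemma partition_rearrangement_unique:
  assumes "partition_seq \<mu>" "partition_seq \<nu>" and "m \<in> rearrangements \<mu>" "m \<in> rearrangements \<nu>"
  shows "\<mu> = \<nu>"
proof -
  have card_eq: "card {k. t < Poly_Mapping.lookup m k} = card {k. t < Poly_Mapping.lookup \<kappa> k}"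
    if "m \<in> rearrangements \<kappa>" for t \<kappa>
  proof -
    obtain \<pi> where \<pi>: "bij \<pi>" "Poly_Mapping.lookup m = Poly_Mapping.lookup \<kappa> \<circ> \<pi>"
      using \<open>m \<in> rearrangements \<kappa>\<close> by (auto simp: rearrangements_def)
    have "bij_betw \<pi> (\<pi> -` {k. t < Poly_Mapping.lookup \<kappa> k}) {k. t < Poly_Mapping.lookup \<kappa> k}"
      by (rule bij_betw_vimage[OF \<pi>(1)])
    from bij_betw_same_card[OF this] show ?thesis by (simp add: \<pi>(2) vimage_def)
  qed
  have "t < Poly_Mapping.lookup \<mu> i \<longleftrightarrow> t < Poly_Mapping.lookup \<nu> i" for t i
    using partition_seq_less_iff[OF assms(1), of t i] partition_seq_less_iff[OF assms(2), of t i]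
      card_eq[OF assms(3), of t] card_eq[OF assms(4), of t] by simp
  then show ?thesis
    by (intro poly_mapping_eqI) (metis less_irrefl linorder_neqE_nat)
qed

text \<open>Convergence is coefficientwise over discrete integers, so it is enough that each coefficient
  receives contributions only from the finitely many summands with index in \<open>F m\<close>.\<close>

lemma has_sum_xseriesI:
  fixes f :: "'a \<Rightarrow> xseries"
  assumes "\<And>m. finite (F m)" "\<And>m. F m \<subseteq> A"
    and "\<And>m a. a \<in> A - F m \<Longrightarrow> xcoeff (f a) m = 0"
    and "\<And>m. (\<Sum>a\<in>F m. xcoeff (f a) m) = xcoeff s m"
  shows "(f has_sum s) A"
  unfolding has_sum_def tendsto_xseries_iff
proof
  fix m
  show "\<forall>\<^sub>F S in finite_subsets_at_top A. xcoeff (sum f S) m = xcoeff s m"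
  proof (subst eventually_finite_subsets_at_top, intro exI[of _ "F m"] conjI allI impI)
    fix S assume S: "finite S \<and> F m \<subseteq> S \<and> S \<subseteq> A"
    then have "(\<Sum>a\<in>S. xcoeff (f a) m) = (\<Sum>a\<in>F m. xcoeff (f a) m)"
      by (intro sum.mono_neutral_right) (use assms(3) in auto)
    then show "xcoeff (sum f S) m = xcoeff s m" by (simp add: assms(4))
  qed (simp_all add: assms(1,2))
qed

theorem mainTheorem9:
  fixes lam :: "nat \<Rightarrow>\<^sub>0 nat"
  assumes "partition_seq lam"
  shows "((\<lambda>T. xpow (tableau_content lam T)) has_sum schur (Poly_Mapping.map int lam)) (tableaux lam)
    \<and> ((\<lambda>\<mu>. of_nat (kostka lam \<mu>) * monomial_sym \<mu>) has_sum schur (Poly_Mapping.map int lam))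
           {\<mu>. partition_seq \<mu>}"
proof
  show "((\<lambda>T. xpow (tableau_content lam T)) has_sum schur (Poly_Mapping.map int lam)) (tableaux lam)"
    by (rule has_sum_xseriesI[of "\<lambda>m. {T \<in> tableaux lam. tableau_content lam T = m}"])
       (auto simp: finite_tableaux_with_content xpow_eq xcoeff_schur[OF assms] kostka_def)
next
  show "((\<lambda>\<mu>. of_nat (kostka lam \<mu>) * monomial_sym \<mu>) has_sum schur (Poly_Mapping.map int lam))
           {\<mu>. partition_seq \<mu>}"
  proof (rule has_sum_xseriesI[of "\<lambda>m. {\<mu>. partition_seq \<mu> \<and> m \<in> rearrangements \<mu>}"])
    fix m
    obtain \<mu> where \<mu>: "partition_seq \<mu>" "m \<in> rearrangements \<mu>"
      using ex_partition_rearrangement by blast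
    then have single: "{\<mu>. partition_seq \<mu> \<and> m \<in> rearrangements \<mu>} = {\<mu>}"
      using partition_rearrangement_unique by blast
    then show "finite {\<mu>. partition_seq \<mu> \<and> m \<in> rearrangements \<mu>}" by simp
    show "(\<Sum>\<mu>\<in>{\<mu>. partition_seq \<mu> \<and> m \<in> rearrangements \<mu>}. xcoeff (of_nat (kostka lam \<mu>) * monomial_sym \<mu>) m)
        = xcoeff (schur (Poly_Mapping.map int lam)) m"
      unfolding single using \<mu>
      by (simp add: xcoeff_of_nat_mult monomial_sym_eq xcoeff_schur[OF assms]
          kostka_rearrangement[OF assms \<mu>(2)])
  qed (auto simp: xcoeff_of_nat_mult monomial_sym_eq)
qed

end
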